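(* Let $G$ be a second countable locally compact group, let $a\in G$ be an aperiodic element, let $w$ be a weight on $G$ with $w,w^{-1}\in L^\infty(G)$, and let $\Phi$ be a $\Delta_2$-regular Young function. Let $T_{a,w}$ be the weighted translation $T_{a,w}f(x)=w(x)f(xa^{-1})$ on the Orlicz space $L^\Phi(G)$. For $n\in\mathbb{N}$ and $x\in G$ put $$\varphi_{n}(x)=\prod_{j=1}^{n}w(xa^{j}),\qquad \widetilde{\varphi}_{n}(x)=\Big(\prod_{j=0}^{n-1}w(xa^{-j})\Big)^{-1}.$$ Then the following conditions are equivalent. (i) $T_{a,w}$ is topologically mixing on $L^\Phi(G)$. (ii) For each compact subset $K\subset G$ with $\lambda(K)>0$, there is a sequence $(E_n)$ of Borel subsets of $K$ such that $\lambda(K)=\lim_{n\to\infty}\lambda(E_n)$ and $$\lim_{n\to\infty}\big\|\varphi_{n}|_{E_n}\big\|_\infty=\lim_{n\to\infty}\big\|\widetilde{\varphi}_{n}|_{E_n}\big\|_\infty=0.$$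
   Context: Locally compact groups are Hausdorff; $\lambda$ is a right Haar measure on $G$; $\mathbb{N}$ is the set of positive integers. An element $a\in G$ is aperiodic if the closed subgroup of $G$ generated by $a$ is not compact. A Young function is a continuous, even, convex function $\Phi:\mathbb{R}\to\mathbb{R}$ with $\Phi(0)=0$, $\Phi(t)>0$ for $t>0$, and $\lim_{t\to\infty}\Phi(t)=\infty$. It is $\Delta_2$-regular (relative to $G$) if there is a constant $M>0$ such that $\Phi(2t)\le M\Phi(t)$ for all $t>0$ when $G$ is noncompact; when $G$ is compact, it is only required that there exist $M>0$ and $t_0>0$ with $\Phi(2t)\le M\Phi(t)$ for all $t\ge t_0$. The Orlicz space $L^\Phi(G)$ is the Banach space of ($\lambda$-a.e. classes of) Borel measurable functions $f:G\to\mathbb{C}$ with $\int_G\Phi(\alpha|f|)\,d\lambda<\infty$ for some $\alpha>0$, with the Luxemburg norm $N_\Phi(f)=\inf\{k>0:\int_G\Phi(|f|/k)\,d\lambda\le 1\}$. A weight on $G$ is a bounded continuous function $w:G\to(0,\infty)$. An operator $T$ on a separable Banach space $X$ is topologically mixing if for all nonempty open $U,V\subset X$ one has $T^nU\cap V\neq\emptyset$ for all $n$ from some point onwards. *)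

theory Defs
  imports "HOL-Analysis.Analysis" "HOL-Probability.Essential_Supremum"
begin

text \<open>
  Groups are types of class \<open>topological_group_add\<close>. The class is written additively but is not
  assumed commutative, so \<open>x a\<^sup>j\<close> becomes \<open>x + nmult j a\<close> and \<open>x a\<^sup>-\<^sup>j\<close> becomes \<open>x - nmult j a\<close>, which
  is \<open>x + (- nmult j a)\<close>; the order of the summands matters throughout.
\<close>

primrec nmult :: "nat \<Rightarrow> 'a::monoid_add \<Rightarrow> 'a" where
  "nmult 0 a = 0"
| "nmult (Suc n) a = a + nmult n a"

definition closed_subgroup :: "'a::topological_group_add set \<Rightarrow> bool" where
  "closed_subgroup H \<longleftrightarrow>
     closed H \<and> 0 \<in> H \<and> (\<forall>x\<in>H. \<forall>y\<in>H. x + y \<in> H) \<and> (\<forall>x\<in>H. - x \<in> H)"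

definition aperiodic :: "'a::topological_group_add \<Rightarrow> bool" where
  "aperiodic a \<longleftrightarrow> \<not> compact (closed_subgroup hull {a})"

text \<open>A right Haar measure: a nonzero Radon measure on the Borel sets, invariant under all right
  translations.\<close>

definition right_haar_measure :: "'a::topological_group_add measure \<Rightarrow> bool" where
  "right_haar_measure \<mu> \<longleftrightarrow>
     sets \<mu> = sets borel \<and>
     emeasure \<mu> (space \<mu>) \<noteq> 0 \<and>
     (\<forall>K. compact K \<longrightarrow> emeasure \<mu> K < \<infinity>) \<and>
     (\<forall>A\<in>sets borel. emeasure \<mu> A = (INF U\<in>{U. open U \<and> A \<subseteq> U}. emeasure \<mu> U)) \<and>
     (\<forall>U. open U \<longrightarrow> emeasure \<mu> U = (SUP K\<in>{K. compact K \<and> K \<subseteq> U}. emeasure \<mu> K)) \<and>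
     (\<forall>A\<in>sets borel. \<forall>g. emeasure \<mu> ((\<lambda>x. x + g) ` A) = emeasure \<mu> A)"

definition young_function :: "(real \<Rightarrow> real) \<Rightarrow> bool" where
  "young_function \<Phi> \<longleftrightarrow>
     continuous_on UNIV \<Phi> \<and> (\<forall>t. \<Phi> (- t) = \<Phi> t) \<and> convex_on UNIV \<Phi> \<and>
     \<Phi> 0 = 0 \<and> (\<forall>t>0. \<Phi> t > 0) \<and> filterlim \<Phi> at_top at_top"

definition delta2_regular :: "'a::topological_space itself \<Rightarrow> (real \<Rightarrow> real) \<Rightarrow> bool" where
  "delta2_regular G \<Phi> \<longleftrightarrow>
     (if compact (UNIV :: 'a set)
      then \<exists>M>0. \<exists>t0>0. \<forall>t\<ge>t0. \<Phi> (2 * t) \<le> M * \<Phi> t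
      else \<exists>M>0. \<forall>t>0. \<Phi> (2 * t) \<le> M * \<Phi> t)"

text \<open>The Orlicz space: first functions, then classes modulo equality almost everywhere.\<close>

definition orlicz_functions :: "'a measure \<Rightarrow> (real \<Rightarrow> real) \<Rightarrow> ('a \<Rightarrow> complex) set" where
  "orlicz_functions \<mu> \<Phi> =
     {f \<in> borel_measurable \<mu>. \<exists>\<alpha>>0. (\<integral>\<^sup>+x. ennreal (\<Phi> (\<alpha> * norm (f x))) \<partial>\<mu>) < \<infinity>}"

definition luxemburg_norm :: "'a measure \<Rightarrow> (real \<Rightarrow> real) \<Rightarrow> ('a \<Rightarrow> complex) \<Rightarrow> real" where
  "luxemburg_norm \<mu> \<Phi> f = Inf {k. k > 0 \<and> (\<integral>\<^sup>+x. ennreal (\<Phi> (norm (f x) / k)) \<partial>\<mu>) \<le> 1}"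

definition orlicz_class ::
  "'a measure \<Rightarrow> (real \<Rightarrow> real) \<Rightarrow> ('a \<Rightarrow> complex) \<Rightarrow> ('a \<Rightarrow> complex) set" where
  "orlicz_class \<mu> \<Phi> f = {g \<in> orlicz_functions \<mu> \<Phi>. AE x in \<mu>. g x = f x}"

definition orlicz_space :: "'a measure \<Rightarrow> (real \<Rightarrow> real) \<Rightarrow> ('a \<Rightarrow> complex) set set" where
  "orlicz_space \<mu> \<Phi> = orlicz_class \<mu> \<Phi> ` orlicz_functions \<mu> \<Phi>"

text \<open>The definitions via \<open>rep\<close> below do not depend on the chosen representative; see
  \<open>orlicz_dist_class\<close> and \<open>weighted_translation_class\<close>.\<close>

definition rep :: "'b set \<Rightarrow> 'b" where
  "rep C = (SOME f. f \<in> C)"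

text \<open>The metric of the Luxemburg norm. It is set to 0 off the carrier because
  \<open>Metric_space\<close> demands nonnegativity for all arguments.\<close>

definition orlicz_dist ::
  "'a measure \<Rightarrow> (real \<Rightarrow> real) \<Rightarrow> ('a \<Rightarrow> complex) set \<Rightarrow> ('a \<Rightarrow> complex) set \<Rightarrow> real" where
  "orlicz_dist \<mu> \<Phi> C D =
     (if C \<in> orlicz_space \<mu> \<Phi> \<and> D \<in> orlicz_space \<mu> \<Phi>
      then luxemburg_norm \<mu> \<Phi> (\<lambda>x. rep C x - rep D x) else 0)"

definition orlicz_topology ::
  "'a measure \<Rightarrow> (real \<Rightarrow> real) \<Rightarrow> ('a \<Rightarrow> complex) set topology" where
  "orlicz_topology \<mu> \<Phi> = Metric_space.mtopology (orlicz_space \<mu> \<Phi>) (orlicz_dist \<mu> \<Phi>)"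

text \<open>Taking the essential supremum in \<open>ennreal\<close> makes the norm 0, not \<open>-\<infinity>\<close>, over a null
  measure space.\<close>

definition linfty_norm :: "'a measure \<Rightarrow> ('a \<Rightarrow> real) \<Rightarrow> ennreal" where
  "linfty_norm \<mu> f = esssup \<mu> (\<lambda>x. ennreal \<bar>f x\<bar>)"

definition linfty :: "'a measure \<Rightarrow> ('a \<Rightarrow> real) set" where
  "linfty \<mu> = {f \<in> borel_measurable \<mu>. linfty_norm \<mu> f < \<infinity>}"

definition weight :: "('a::topological_space \<Rightarrow> real) \<Rightarrow> bool" where
  "weight w \<longleftrightarrow> continuous_on UNIV w \<and> bounded (range w) \<and> (\<forall>x. w x > 0)"

definition translate_fun ::
  "'a::group_add \<Rightarrow> ('a \<Rightarrow> real) \<Rightarrow> ('a \<Rightarrow> complex) \<Rightarrow> 'a \<Rightarrow> complex" where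
  "translate_fun a w f = (\<lambda>x. of_real (w x) * f (x - a))"

definition weighted_translation ::
  "'a::group_add measure \<Rightarrow> (real \<Rightarrow> real) \<Rightarrow> 'a \<Rightarrow> ('a \<Rightarrow> real)
     \<Rightarrow> ('a \<Rightarrow> complex) set \<Rightarrow> ('a \<Rightarrow> complex) set" where
  "weighted_translation \<mu> \<Phi> a w C = orlicz_class \<mu> \<Phi> (translate_fun a w (rep C))"

definition topologically_mixing :: "'b topology \<Rightarrow> ('b \<Rightarrow> 'b) \<Rightarrow> bool" where
  "topologically_mixing X T \<longleftrightarrow>
     (\<forall>U V. openin X U \<and> U \<noteq> {} \<and> openin X V \<and> V \<noteq> {} \<longrightarrow>
        (\<exists>N. \<forall>n\<ge>N. (T ^^ n) ` U \<inter> V \<noteq> {}))"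

definition weight_prod :: "'a::group_add \<Rightarrow> ('a \<Rightarrow> real) \<Rightarrow> nat \<Rightarrow> 'a \<Rightarrow> real" where
  "weight_prod a w n x = (\<Prod>j=1..n. w (x + nmult j a))"

definition weight_prod_tilde :: "'a::group_add \<Rightarrow> ('a \<Rightarrow> real) \<Rightarrow> nat \<Rightarrow> 'a \<Rightarrow> real" where
  "weight_prod_tilde a w n x = inverse (\<Prod>j<n. w (x - nmult j a))"


subsection \<open>Well-definedness: the metric and the operator on classes\<close>

lemma young_scale:
  assumes "young_function \<Phi>" "0 \<le> c" "c \<le> 1"
  shows "\<Phi> (c * t) \<le> c * \<Phi> t"
proof -
  have cv: "convex_on UNIV \<Phi>" and z: "\<Phi> 0 = 0"
    using assms(1) by (auto simp: young_function_def)
  from convex_onD[OF cv, of c 0 t] assms z show ?thesis by simp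
qed

lemma young_nonneg:
  assumes "young_function \<Phi>" shows "0 \<le> \<Phi> t"
proof -
  have "\<Phi> \<bar>t\<bar> = \<Phi> t" using assms by (auto simp: young_function_def abs_if)
  moreover have "0 \<le> \<Phi> \<bar>t\<bar>"
    using assms by (cases "t = 0") (auto simp: young_function_def less_imp_le)
  ultimately show ?thesis by simp
qed

lemma young_mono:
  assumes "young_function \<Phi>" "0 \<le> s" "s \<le> t"
  shows "\<Phi> s \<le> \<Phi> t"
proof (cases "t = 0")
  case False
  then have t: "t > 0" using assms by linarith
  have "\<Phi> ((s / t) * t) \<le> (s / t) * \<Phi> t"
    using young_scale[OF assms(1), of "s / t" t] assms t by simp
  also have "\<dots> \<le> 1 * \<Phi> t"
    by (rule mult_right_mono) (use assms t young_nonneg[OF assms(1)] in auto)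
  finally show ?thesis using t by simp
qed (use assms in auto)

lemma young_measurable:
  assumes "young_function \<Phi>" shows "\<Phi> \<in> borel_measurable borel"
  using assms by (auto simp: young_function_def intro: borel_measurable_continuous_onI)

abbreviation modular where
  "modular \<mu> \<Phi> f k \<equiv> (\<integral>\<^sup>+x. ennreal (\<Phi> (norm (f x :: complex) / k)) \<partial>\<mu>)"

lemma modular_mono:
  assumes "young_function \<Phi>" "0 < k" "k \<le> l"
  shows "modular \<mu> \<Phi> f l \<le> modular \<mu> \<Phi> f k"
  by (intro nn_integral_mono ennreal_leI young_mono[OF assms(1)])
    (use assms in \<open>auto intro: divide_left_mono\<close>)

lemma modular_nonempty:
  assumes Y: "young_function \<Phi>" and f: "f \<in> orlicz_functions \<mu> \<Phi>"
  shows "\<exists>k>0. modular \<mu> \<Phi> f k \<le> 1"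
proof -
  obtain \<alpha> where a: "\<alpha> > 0" and fin: "(\<integral>\<^sup>+x. ennreal (\<Phi> (\<alpha> * norm (f x))) \<partial>\<mu>) < \<infinity>"
    and m[measurable]: "f \<in> borel_measurable \<mu>"
    using f by (auto simp: orlicz_functions_def)
  note [measurable] = young_measurable[OF Y]
  let ?I = "\<integral>\<^sup>+x. ennreal (\<Phi> (\<alpha> * norm (f x))) \<partial>\<mu>"
  obtain r where r: "?I = ennreal r" "r \<ge> 0"
    using fin by (metis ennreal_cases infinity_ennreal_def less_irrefl)
  define c where "c = 1 / (r + 1)"
  have c: "0 < c" "c \<le> 1" "c * r \<le> 1" using r by (auto simp: c_def field_simps)
  have "modular \<mu> \<Phi> f (1 / (c * \<alpha>)) \<le> (\<integral>\<^sup>+x. ennreal c * ennreal (\<Phi> (\<alpha> * norm (f x))) \<partial>\<mu>)"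
  proof (intro nn_integral_mono)
    fix x
    have "\<Phi> (c * (\<alpha> * norm (f x))) \<le> c * \<Phi> (\<alpha> * norm (f x))"
      using young_scale[OF Y] c by simp
    then show "ennreal (\<Phi> (norm (f x) / (1 / (c * \<alpha>)))) \<le> ennreal c * ennreal (\<Phi> (\<alpha> * norm (f x)))"
      using c young_nonneg[OF Y]
      by (simp add: ennreal_mult[symmetric] mult_ac ennreal_leI)
  qed
  also have "\<dots> = ennreal c * ?I" by (rule nn_integral_cmult) measurable
  also have "\<dots> = ennreal (c * r)" using c r by (simp add: ennreal_mult)
  also have "\<dots> \<le> 1" using c by (simp add: ennreal_le_1)
  finally show ?thesis using a c by (intro exI[of _ "1 / (c * \<alpha>)"]) auto
qed

lemma orlicz_functionsI:
  assumes "f \<in> borel_measurable \<mu>" "k > 0" "modular \<mu> \<Phi> f k \<le> 1"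
  shows "f \<in> orlicz_functions \<mu> \<Phi>"
proof -
  have "(\<integral>\<^sup>+x. ennreal (\<Phi> ((1 / k) * norm (f x))) \<partial>\<mu>) < \<infinity>"
    using assms(3) by (simp add: order_le_less_trans[OF _ ennreal_one_less_top])
  then show ?thesis using assms unfolding orlicz_functions_def
    by (auto intro!: exI[of _ "1 / k"])
qed

lemma luxemburg_nonneg:
  assumes "young_function \<Phi>" "f \<in> orlicz_functions \<mu> \<Phi>"
  shows "0 \<le> luxemburg_norm \<mu> \<Phi> f"
  unfolding luxemburg_norm_def
  by (rule cInf_greatest) (use modular_nonempty[OF assms] in auto)

lemma luxemburg_le:
  assumes "k > 0" "modular \<mu> \<Phi> f k \<le> 1"
  shows "luxemburg_norm \<mu> \<Phi> f \<le> k"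
  unfolding luxemburg_norm_def
  by (rule cInf_lower) (use assms in \<open>auto intro!: bdd_belowI[of _ 0]\<close>)

lemma luxemburg_less:
  assumes "young_function \<Phi>" "f \<in> orlicz_functions \<mu> \<Phi>" "luxemburg_norm \<mu> \<Phi> f < k"
  shows "k > 0" "modular \<mu> \<Phi> f k \<le> 1"
proof -
  have "\<exists>l\<in>{k. k > 0 \<and> modular \<mu> \<Phi> f k \<le> 1}. l < k"
    using assms(3) modular_nonempty[OF assms(1,2)] unfolding luxemburg_norm_def
    by (subst (asm) cInf_less_iff) (auto intro!: bdd_belowI[of _ 0])
  then obtain l where l: "l > 0" "modular \<mu> \<Phi> f l \<le> 1" "l < k" by auto
  show "k > 0" using l by simp
  show "modular \<mu> \<Phi> f k \<le> 1"
    using modular_mono[OF assms(1), of l k \<mu> f] l by (auto intro: order_trans)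
qed

lemma modular_add:
  assumes Y: "young_function \<Phi>" and [measurable]: "f \<in> borel_measurable \<mu>" "g \<in> borel_measurable \<mu>"
    and k: "k > 0" "modular \<mu> \<Phi> f k \<le> 1" and l: "l > 0" "modular \<mu> \<Phi> g l \<le> 1"
  shows "modular \<mu> \<Phi> (\<lambda>x. f x + g x) (k + l) \<le> 1"
proof -
  note [measurable] = young_measurable[OF Y]
  define c where "c = k / (k + l)"
  have c: "0 \<le> c" "0 \<le> 1 - c" "c / k = 1 / (k + l)" "(1 - c) / l = 1 / (k + l)"
    proof -
    have "k + l > 0" "1 - c = l / (k + l)" using k l by (auto simp: c_def field_simps)
    then show "0 \<le> c" "0 \<le> 1 - c" "c / k = 1 / (k + l)" "(1 - c) / l = 1 / (k + l)"
      using k l by (auto simp: c_def)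
  qed
  have cv: "convex_on UNIV \<Phi>" using Y by (auto simp: young_function_def)
  have "modular \<mu> \<Phi> (\<lambda>x. f x + g x) (k + l)
      \<le> (\<integral>\<^sup>+x. ennreal c * ennreal (\<Phi> (norm (f x) / k)) + ennreal (1 - c) * ennreal (\<Phi> (norm (g x) / l)) \<partial>\<mu>)"
  proof (intro nn_integral_mono)
    fix x
    have "norm (f x + g x) / (k + l) \<le> (norm (f x) + norm (g x)) / (k + l)"
      using k l by (intro divide_right_mono norm_triangle_ineq) auto
    also have "\<dots> = norm (f x) * (c / k) + norm (g x) * ((1 - c) / l)"
      unfolding c by (simp add: add_divide_distrib)
    also have "\<dots> = c * (norm (f x) / k) + (1 - c) * (norm (g x) / l)" by (simp add: mult.commute)
    finally have "\<Phi> (norm (f x + g x) / (k + l)) \<le> \<Phi> (c * (norm (f x) / k) + (1 - c) * (norm (g x) / l))"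
      using k l by (intro young_mono[OF Y]) auto
    also have "\<dots> \<le> c * \<Phi> (norm (f x) / k) + (1 - c) * \<Phi> (norm (g x) / l)"
      using convex_onD[OF cv, of "1 - c" "norm (f x) / k" "norm (g x) / l"] c by simp
    finally show "ennreal (\<Phi> (norm (f x + g x) / (k + l)))
        \<le> ennreal c * ennreal (\<Phi> (norm (f x) / k)) + ennreal (1 - c) * ennreal (\<Phi> (norm (g x) / l))"
      using c young_nonneg[OF Y]
      by (simp add: ennreal_mult[symmetric] ennreal_plus[symmetric] ennreal_leI del: ennreal_plus)
  qed
  also have "\<dots> = ennreal c * modular \<mu> \<Phi> f k + ennreal (1 - c) * modular \<mu> \<Phi> g l"
    by (subst nn_integral_add) (auto simp: nn_integral_cmult)
  also have "\<dots> \<le> ennreal c * 1 + ennreal (1 - c) * 1"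
    using k l by (intro add_mono mult_left_mono) auto
  also have "\<dots> = 1" using c by (simp add: ennreal_plus[symmetric] del: ennreal_plus)
  finally show ?thesis .
qed

lemma orlicz_diff:
  assumes Y: "young_function \<Phi>" and f: "f \<in> orlicz_functions \<mu> \<Phi>" and g: "g \<in> orlicz_functions \<mu> \<Phi>"
  shows "(\<lambda>x. f x - g x) \<in> orlicz_functions \<mu> \<Phi>"
proof -
  have [measurable]: "f \<in> borel_measurable \<mu>" "g \<in> borel_measurable \<mu>"
    using f g by (auto simp: orlicz_functions_def)
  obtain k l where "k > 0" "modular \<mu> \<Phi> f k \<le> 1" "l > 0" "modular \<mu> \<Phi> g l \<le> 1"
    using modular_nonempty[OF Y f] modular_nonempty[OF Y g] by auto
  then show ?thesis
    using modular_add[OF Y, of f \<mu> "\<lambda>x. - g x" k l]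
    by (intro orlicz_functionsI[of _ _ "k + l"]) auto
qed

lemma luxemburg_triangle:
  assumes Y: "young_function \<Phi>" and f: "f \<in> orlicz_functions \<mu> \<Phi>" and g: "g \<in> orlicz_functions \<mu> \<Phi>"
  shows "luxemburg_norm \<mu> \<Phi> (\<lambda>x. f x + g x) \<le> luxemburg_norm \<mu> \<Phi> f + luxemburg_norm \<mu> \<Phi> g"
proof (rule field_le_epsilon)
  fix e :: real assume e: "e > 0"
  have [measurable]: "f \<in> borel_measurable \<mu>" "g \<in> borel_measurable \<mu>"
    using f g by (auto simp: orlicz_functions_def)
  define k l where "k = luxemburg_norm \<mu> \<Phi> f + e / 2" and "l = luxemburg_norm \<mu> \<Phi> g + e / 2"
  have "luxemburg_norm \<mu> \<Phi> f < k" "luxemburg_norm \<mu> \<Phi> g < l" using e by (auto simp: k_def l_def)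
  note kl = luxemburg_less[OF Y f this(1)] luxemburg_less[OF Y g this(2)]
  have "luxemburg_norm \<mu> \<Phi> (\<lambda>x. f x + g x) \<le> k + l"
    using kl by (intro luxemburg_le modular_add[OF Y]) auto
  then show "luxemburg_norm \<mu> \<Phi> (\<lambda>x. f x + g x)
      \<le> luxemburg_norm \<mu> \<Phi> f + luxemburg_norm \<mu> \<Phi> g + e"
    by (simp add: k_def l_def)
qed

lemma luxemburg_cong_AE:
  assumes "AE x in \<mu>. norm (f x) = norm (g x)"
  shows "luxemburg_norm \<mu> \<Phi> f = luxemburg_norm \<mu> \<Phi> g"
proof -
  have "modular \<mu> \<Phi> f k = modular \<mu> \<Phi> g k" for k
    by (rule nn_integral_cong_AE) (use assms in auto)
  then show ?thesis by (simp add: luxemburg_norm_def)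
qed

lemma luxemburg_eq_0_iff:
  assumes Y: "young_function \<Phi>" and f: "f \<in> orlicz_functions \<mu> \<Phi>"
  shows "luxemburg_norm \<mu> \<Phi> f = 0 \<longleftrightarrow> (AE x in \<mu>. f x = 0)"
proof
  note [measurable] = young_measurable[OF Y]
  have [measurable]: "f \<in> borel_measurable \<mu>" using f by (auto simp: orlicz_functions_def)
  assume 0: "luxemburg_norm \<mu> \<Phi> f = 0"
  have le: "modular \<mu> \<Phi> f 1 \<le> ennreal k" if k: "0 < k" "k \<le> 1" for k
  proof -
    have "modular \<mu> \<Phi> f 1 \<le> (\<integral>\<^sup>+x. ennreal k * ennreal (\<Phi> (norm (f x) / k)) \<partial>\<mu>)"
    proof (intro nn_integral_mono)
      fix x
      have "\<Phi> (k * (norm (f x) / k)) \<le> k * \<Phi> (norm (f x) / k)"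
        by (rule young_scale[OF Y]) (use k in auto)
      then show "ennreal (\<Phi> (norm (f x) / 1)) \<le> ennreal k * ennreal (\<Phi> (norm (f x) / k))"
        using k young_nonneg[OF Y] by (simp add: ennreal_mult[symmetric] ennreal_leI)
    qed
    also have "\<dots> = ennreal k * modular \<mu> \<Phi> f k" by (rule nn_integral_cmult) measurable
    also have "\<dots> \<le> ennreal k * 1"
      using luxemburg_less(2)[OF Y f, of k] 0 k by (intro mult_left_mono) auto
    finally show ?thesis by simp
  qed
  have "modular \<mu> \<Phi> f 1 \<le> 0"
  proof (rule ennreal_le_epsilon)
    fix e :: real assume "e > 0"
    then have "modular \<mu> \<Phi> f 1 \<le> ennreal (min e 1)" by (intro le) auto
    also have "\<dots> \<le> ennreal e" by (intro ennreal_leI) simp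
    finally show "modular \<mu> \<Phi> f 1 \<le> 0 + ennreal e" by simp
  qed
  then have "modular \<mu> \<Phi> f 1 = 0" by simp
  then have "AE x in \<mu>. ennreal (\<Phi> (norm (f x) / 1)) = 0"
    by (subst (asm) nn_integral_0_iff_AE) auto
  then show "AE x in \<mu>. f x = 0"
  proof (rule AE_mp, intro AE_I2 impI)
    fix x assume "ennreal (\<Phi> (norm (f x) / 1)) = 0"
    then have "\<not> \<Phi> (norm (f x)) > 0" by (metis div_by_1 ennreal_eq_0_iff not_le)
    then have "\<not> 0 < norm (f x)" using Y unfolding young_function_def by blast
    then show "f x = 0" by simp
  qed
next
  assume "AE x in \<mu>. f x = 0"
  then have "modular \<mu> \<Phi> f k = (\<integral>\<^sup>+x. 0 \<partial>\<mu>)" for k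
    by (intro nn_integral_cong_AE) (use Y in \<open>auto simp: young_function_def\<close>)
  then have "luxemburg_norm \<mu> \<Phi> f = Inf {k. k > (0::real)}" by (simp add: luxemburg_norm_def)
  also have "\<dots> = 0" using cInf_greaterThan[of "0::real"] by (simp add: greaterThan_def)
  finally show "luxemburg_norm \<mu> \<Phi> f = 0" .
qed

lemma rep_orlicz:
  assumes "C \<in> orlicz_space \<mu> \<Phi>"
  shows "rep C \<in> orlicz_functions \<mu> \<Phi>" "orlicz_class \<mu> \<Phi> (rep C) = C"
proof -
  obtain f where f: "f \<in> orlicz_functions \<mu> \<Phi>" "C = orlicz_class \<mu> \<Phi> f"
    using assms by (auto simp: orlicz_space_def)
  then have "f \<in> C" by (simp add: orlicz_class_def)
  then have r: "rep C \<in> C" unfolding rep_def by (rule someI[of "\<lambda>f. f \<in> C"])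
  then show "rep C \<in> orlicz_functions \<mu> \<Phi>" using f by (simp add: orlicz_class_def)
  have ae: "AE x in \<mu>. rep C x = f x" using r f by (simp add: orlicz_class_def)
  show "orlicz_class \<mu> \<Phi> (rep C) = C"
    unfolding f(2) orlicz_class_def using ae unfolding f(2) orlicz_class_def by auto
qed

lemma orlicz_class_eq_iff:
  assumes "f \<in> orlicz_functions \<mu> \<Phi>" "g \<in> orlicz_functions \<mu> \<Phi>"
  shows "orlicz_class \<mu> \<Phi> f = orlicz_class \<mu> \<Phi> g \<longleftrightarrow> (AE x in \<mu>. f x = g x)"
proof
  assume "orlicz_class \<mu> \<Phi> f = orlicz_class \<mu> \<Phi> g"
  moreover have "f \<in> orlicz_class \<mu> \<Phi> f" using assms by (simp add: orlicz_class_def)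
  ultimately show "AE x in \<mu>. f x = g x" by (simp add: orlicz_class_def)
next
  assume ae: "AE x in \<mu>. f x = g x"
  show "orlicz_class \<mu> \<Phi> f = orlicz_class \<mu> \<Phi> g"
    using ae unfolding orlicz_class_def by auto
qed

lemma orlicz_dist_class:
  assumes f: "f \<in> orlicz_functions \<mu> \<Phi>" and g: "g \<in> orlicz_functions \<mu> \<Phi>"
  shows "orlicz_dist \<mu> \<Phi> (orlicz_class \<mu> \<Phi> f) (orlicz_class \<mu> \<Phi> g)
    = luxemburg_norm \<mu> \<Phi> (\<lambda>x. f x - g x)"
proof -
  have s: "orlicz_class \<mu> \<Phi> f \<in> orlicz_space \<mu> \<Phi>" "orlicz_class \<mu> \<Phi> g \<in> orlicz_space \<mu> \<Phi>"
    using f g by (auto simp: orlicz_space_def)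
  have "AE x in \<mu>. rep (orlicz_class \<mu> \<Phi> f) x = f x"
    using rep_orlicz[OF s(1)] orlicz_class_eq_iff f by blast
  moreover have "AE x in \<mu>. rep (orlicz_class \<mu> \<Phi> g) x = g x"
    using rep_orlicz[OF s(2)] orlicz_class_eq_iff g by blast
  ultimately have "AE x in \<mu>. norm (rep (orlicz_class \<mu> \<Phi> f) x - rep (orlicz_class \<mu> \<Phi> g) x)
      = norm (f x - g x)" by auto
  then show ?thesis using s by (simp add: orlicz_dist_def luxemburg_cong_AE)
qed

lemma orlicz_Metric_space:
  assumes Y: "young_function \<Phi>"
  shows "Metric_space (orlicz_space \<mu> \<Phi>) (orlicz_dist \<mu> \<Phi>)"
proof
  fix C D
  show "0 \<le> orlicz_dist \<mu> \<Phi> C D"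
    by (auto simp: orlicz_dist_def intro!: luxemburg_nonneg[OF Y] orlicz_diff[OF Y] rep_orlicz)
  show "orlicz_dist \<mu> \<Phi> C D = orlicz_dist \<mu> \<Phi> D C"
    by (auto simp: orlicz_dist_def norm_minus_commute intro!: luxemburg_cong_AE)
next
  fix C D assume CD: "C \<in> orlicz_space \<mu> \<Phi>" "D \<in> orlicz_space \<mu> \<Phi>"
  note r = rep_orlicz[OF CD(1)] rep_orlicz[OF CD(2)]
  show "orlicz_dist \<mu> \<Phi> C D = 0 \<longleftrightarrow> C = D"
    using CD r orlicz_class_eq_iff[of "rep C" \<mu> \<Phi> "rep D"]
      luxemburg_eq_0_iff[OF Y orlicz_diff[OF Y r(1) r(3)]]
    by (simp add: orlicz_dist_def)
next
  fix C D E assume CDE: "C \<in> orlicz_space \<mu> \<Phi>" "D \<in> orlicz_space \<mu> \<Phi>" "E \<in> orlicz_space \<mu> \<Phi>"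
  show "orlicz_dist \<mu> \<Phi> C E \<le> orlicz_dist \<mu> \<Phi> C D + orlicz_dist \<mu> \<Phi> D E"
    using CDE luxemburg_triangle[OF Y, of "\<lambda>x. rep C x - rep D x" \<mu> "\<lambda>x. rep D x - rep E x"]
    by (simp add: orlicz_dist_def orlicz_diff[OF Y] rep_orlicz)
qed

lemma right_haar_distr:
  fixes \<mu> :: "'a::topological_group_add measure"
  assumes h: "right_haar_measure \<mu>"
  shows "(\<lambda>x. x - a) \<in> measurable \<mu> \<mu>" "distr \<mu> \<mu> (\<lambda>x. x - a) = \<mu>"
proof -
  have s: "sets \<mu> = sets borel" using h by (simp add: right_haar_measure_def)
  have "continuous_on UNIV (\<lambda>x::'a. x - a)" by (intro continuous_intros)
  then have "(\<lambda>x. x - a) \<in> borel_measurable borel" by (rule borel_measurable_continuous_onI)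
  then show m: "(\<lambda>x. x - a) \<in> measurable \<mu> \<mu>"
    using measurable_cong_sets[OF s s] by auto
  show "distr \<mu> \<mu> (\<lambda>x. x - a) = \<mu>"
  proof (rule measure_eqI)
    fix A assume "A \<in> sets (distr \<mu> \<mu> (\<lambda>x. x - a))"
    then have A: "A \<in> sets \<mu>" by simp
    have "(\<lambda>x. x - a) -` A \<inter> space \<mu> = (\<lambda>x. x + a) ` A"
      using sets_eq_imp_space_eq[OF s] by (force simp: image_iff)
    then show "emeasure (distr \<mu> \<mu> (\<lambda>x. x - a)) A = emeasure \<mu> A"
      using h A s by (simp add: emeasure_distr[OF m A] right_haar_measure_def)
  qed simp
qed

lemma translate_fun_orlicz:
  fixes \<mu> :: "'a::topological_group_add measure"
  assumes h: "right_haar_measure \<mu>" and Y: "young_function \<Phi>" and w: "weight w"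
    and f: "f \<in> orlicz_functions \<mu> \<Phi>"
  shows "translate_fun a w f \<in> orlicz_functions \<mu> \<Phi>"
proof -
  note [measurable] = young_measurable[OF Y] right_haar_distr(1)[OF h]
  have s: "sets \<mu> = sets borel" using h by (simp add: right_haar_measure_def)
  have "w \<in> borel_measurable borel"
    using w by (auto simp: weight_def intro: borel_measurable_continuous_onI)
  then have [measurable]: "w \<in> borel_measurable \<mu>" using s by (simp cong: measurable_cong_sets)
  have fm[measurable]: "f \<in> borel_measurable \<mu>" using f by (auto simp: orlicz_functions_def)
  have [measurable]: "(\<lambda>x. f (x - a)) \<in> borel_measurable \<mu>"
    using measurable_compose[OF right_haar_distr(1)[OF h] fm] .
  obtain B where B: "B > 0" "\<And>x. \<bar>w x\<bar> \<le> B"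
    using w by (auto simp: weight_def bounded_pos)
  obtain k where k: "k > 0" "modular \<mu> \<Phi> f k \<le> 1" using modular_nonempty[OF Y f] by auto
  have "modular \<mu> \<Phi> (translate_fun a w f) (B * k) \<le> (\<integral>\<^sup>+x. ennreal (\<Phi> (norm (f (x - a)) / k)) \<partial>\<mu>)"
  proof (intro nn_integral_mono ennreal_leI young_mono[OF Y])
    fix x
    show "norm (translate_fun a w f x) / (B * k) \<le> norm (f (x - a)) / k"
      using B k mult_right_mono[OF B(2)[of x] norm_ge_zero[of "f (x - a)"]]
      by (simp add: translate_fun_def norm_mult field_simps)
  qed (use B k in auto)
  also have "\<dots> = (\<integral>\<^sup>+x. ennreal (\<Phi> (norm (f x) / k)) \<partial>distr \<mu> \<mu> (\<lambda>x. x - a))"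
    by (rule nn_integral_distr[symmetric]) measurable
  also have "\<dots> \<le> 1" using k by (simp add: right_haar_distr(2)[OF h])
  finally show ?thesis
    by (rule orlicz_functionsI[rotated 2]) (use B k in \<open>auto simp: translate_fun_def\<close>)
qed

lemma weighted_translation_class:
  fixes \<mu> :: "'a::topological_group_add measure"
  assumes h: "right_haar_measure \<mu>" and Y: "young_function \<Phi>" and w: "weight w"
    and f: "f \<in> orlicz_functions \<mu> \<Phi>"
  shows "weighted_translation \<mu> \<Phi> a w (orlicz_class \<mu> \<Phi> f) = orlicz_class \<mu> \<Phi> (translate_fun a w f)"
proof -
  let ?g = "rep (orlicz_class \<mu> \<Phi> f)"
  have C: "orlicz_class \<mu> \<Phi> f \<in> orlicz_space \<mu> \<Phi>" using f by (auto simp: orlicz_space_def)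
  note r = rep_orlicz[OF C]
  have ae: "AE x in \<mu>. ?g x = f x" using r f orlicz_class_eq_iff by blast
  have [measurable]: "?g \<in> borel_measurable \<mu>" "f \<in> borel_measurable \<mu>"
    using r f by (auto simp: orlicz_functions_def)
  have "AE x in distr \<mu> \<mu> (\<lambda>x. x - a). ?g x = f x"
    unfolding right_haar_distr(2)[OF h] by (rule ae)
  then have "AE x in \<mu>. ?g (x - a) = f (x - a)"
    by (subst (asm) AE_distr_iff[OF right_haar_distr(1)[OF h]]) measurable
  then have "AE x in \<mu>. translate_fun a w ?g x = translate_fun a w f x"
    by (auto simp: translate_fun_def)
  then show ?thesis unfolding weighted_translation_def
    using orlicz_class_eq_iff translate_fun_orlicz[OF h Y w] r(1) f by blast
qed

end

theory Submission
  imports Defs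
begin

text \<open>
  If \<open>T\<close> is mixing, then for large \<open>n\<close> some \<open>h\<close> and \<open>T\<^sup>n h\<close> are both close to the indicator of \<open>K\<close>.
  Aperiodicity makes \<open>K\<close> disjoint from \<open>K a\<^sup>n\<close> and \<open>K a\<^sup>-\<^sup>n\<close>, so for most \<open>x \<in> K\<close> both \<open>h(x)\<close> and
  \<open>T\<^sup>n h(x)\<close> are near 1, while \<open>T\<^sup>n h(x a\<^sup>n) = \<phi>\<^sub>n(x) h(x)\<close> and \<open>h(x a\<^sup>-\<^sup>n)\<close>, which is the product of
  the second weight and \<open>T\<^sup>n h(x)\<close>, are near 0; Chebyshev's inequality controls the exceptional set.

  Conversely, if \<open>S\<close> is the inverse of \<open>T\<close> and \<open>f, g\<close> are bounded with support in \<open>K\<close>, then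
  \<open>h = f 1\<^sub>E + S\<^sup>n (g 1\<^sub>E)\<close> with \<open>E = E\<^sub>n\<close> is close to \<open>f\<close> and \<open>T\<^sup>n h\<close> is close to \<open>g\<close>. Such functions are dense
  because of the \<open>\<Delta>\<^sub>2\<close> condition, which holds globally since an aperiodic element forces \<open>G\<close> to be
  noncompact.
\<close>

section \<open>Aperiodic elements\<close>

lemma nmult_add: "nmult (m + n) a = nmult m a + nmult n a"
  by (induction m) (auto simp: add.assoc)

lemma nmult_commute: "nmult m a + nmult n a = nmult n a + nmult m a"
  by (metis nmult_add add.commute)

lemma neg_nmult_add_nmult:
  fixes a :: "'a::group_add"
  assumes "m \<le> n"
  shows "- nmult m a + nmult n a = nmult (n - m) a"
  using nmult_add[of m "n - m" a] assms by (simp add: add.assoc[symmetric])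

text \<open>Multiples of one element commute even though the group need not, so the negative
  multiple may stand on either side. This is what makes sums of such differences differences
  again.\<close>

lemma nmult_diff_commute:
  fixes a :: "'a::group_add"
  shows "nmult i a - nmult j a = - nmult j a + nmult i a"
proof -
  have "nmult j a + (nmult i a - nmult j a) = nmult i a"
    by (simp add: add_diff_eq nmult_commute[of j a i])
  then have "- nmult j a + (nmult j a + (nmult i a - nmult j a)) = - nmult j a + nmult i a"
    by simp
  then show ?thesis
    by (simp only: minus_add_cancel)
qed

text \<open>Continuity of both maps at \<open>(0, 0)\<close> gives a product neighbourhood
  \<open>A \<times> B\<close>; intersecting its factors makes one \<open>W\<close> serve for both
  arguments.\<close>

lemma zero_neighbourhood_shrink:
  fixes U :: "'a::topological_group_add set"
  assumes "open U" "0 \<in> U"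
  obtains W where "open W" "0 \<in> W" "\<And>x y. x \<in> W \<Longrightarrow> y \<in> W \<Longrightarrow> x + y \<in> U \<and> - x + y \<in> U"
proof -
  have "open ((\<lambda>p::'a \<times> 'a. fst p + snd p) -` U \<inter> (\<lambda>p::'a \<times> 'a. - fst p + snd p) -` U)"
    using assms(1) by (intro open_Int open_vimage continuous_intros)
  then obtain A B where "open A" "open B" "(0, 0) \<in> A \<times> B"
      "A \<times> B \<subseteq> (\<lambda>p. fst p + snd p) -` U \<inter> (\<lambda>p. - fst p + snd p) -` U"
    by (rule open_prod_elim[where x = "(0, 0)"]) (use assms(2) in auto)
  then show thesis
    by (intro that[of "A \<inter> B"]) auto
qed

text \<open>By the pigeonhole principle infinitely many multiples lie in one small translate; subtract two of them.\<close>

lemma recurrent_multiples: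
  fixes a :: "'a::topological_group_add"
  assumes C: "compact C" and inf: "infinite {n. nmult n a \<in> C}" and U: "open U" "0 \<in> U"
  shows "\<exists>n>N. nmult n a \<in> U"
proof -
  obtain W where W: "open W" "0 \<in> W"
      "\<And>x y. x \<in> W \<Longrightarrow> y \<in> W \<Longrightarrow> x + y \<in> U \<and> - x + y \<in> U"
    by (rule zero_neighbourhood_shrink[OF U]) blast
  have "open ((\<lambda>y. - x + y) -` W)" for x
    using W(1) by (intro open_vimage continuous_intros)
  moreover have "C \<subseteq> (\<Union>x\<in>C. (\<lambda>y. - x + y) -` W)"
    using W(2) by auto
  ultimately obtain F where F: "F \<subseteq> C" "finite F" "C \<subseteq> (\<Union>x\<in>F. (\<lambda>y. - x + y) -` W)"
    using compactE_image[OF C, of C "\<lambda>x. (\<lambda>y. - x + y) -` W"] by blast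
  have "{n. nmult n a \<in> C} \<subseteq> (\<Union>x\<in>F. {n. - x + nmult n a \<in> W})"
    using F(3) by blast
  then obtain x where x: "infinite {n. - x + nmult n a \<in> W}"
    using inf F(2) finite_subset by blast
  then obtain m where m: "- x + nmult m a \<in> W"
    using not_finite_existsD by blast
  \<comment> \<open>Going beyond \<open>m + N\<close> makes \<open>n - m\<close> exceed
    \<open>N\<close>. The base point \<open>x\<close> then cancels in the left difference, the one
    that \<open>W\<close> controls.\<close>
  from x obtain n where n: "n > m + N" "- x + nmult n a \<in> W"
    unfolding infinite_nat_iff_unbounded by auto
  have "- (- x + nmult m a) + (- x + nmult n a) = - nmult m a + nmult n a"
    by (simp add: minus_add add.assoc)
  also have "\<dots> = nmult (n - m) a"
    using n(1) by (intro neg_nmult_add_nmult) simp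
  finally have "nmult (n - m) a \<in> U"
    using W(3)[OF m n(2)] by simp
  then show ?thesis
    using n(1) by (intro exI[of _ "n - m"]) auto
qed

text \<open>Continuous operations carry closures into closures; for addition this is applied on the
  product, where \<open>closure P \<times> closure P\<close> is the closure of
  \<open>P \<times> P\<close>.\<close>

lemma closed_subgroup_closure:
  fixes P :: "'a::topological_group_add set"
  assumes "0 \<in> P" "\<And>x y. x \<in> P \<Longrightarrow> y \<in> P \<Longrightarrow> x + y \<in> P" "\<And>x. x \<in> P \<Longrightarrow> - x \<in> P"
  shows "closed_subgroup (closure P)"
proof -
  have "(\<lambda>p. fst p + snd p) ` closure (P \<times> P) \<subseteq> closure P"
    using assms(2) closure_subset[of P]
    by (intro image_closure_subset continuous_intros) auto
  then have "x + y \<in> closure P" if "x \<in> closure P" "y \<in> closure P" for x y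
    using that unfolding closure_Times by force
  moreover have "uminus ` closure P \<subseteq> closure P"
    using assms(3) closure_subset[of P]
    by (intro image_closure_subset continuous_intros) auto
  ultimately show ?thesis
    using assms(1) closure_subset[of P] by (auto simp: closed_subgroup_def)
qed

lemma closed_hull_closed_subgroup: "closed (closed_subgroup hull S)"
  unfolding hull_def by (intro closed_Inter) (auto simp: closed_subgroup_def)

text \<open>
  Weil's argument: compactness bounds how far one has to go back along the multiples of \<open>a\<close> to return
  to a given compact neighbourhood, so finitely many translates of that neighbourhood cover all
  multiples.
\<close>

lemma compact_hull_if_recurrent:
  fixes a :: "'a::{topological_group_add, t2_space}"
  assumes lc: "locally_compact_space (euclidean :: 'a topology)"
    and C: "compact C" and inf: "infinite {n. nmult n a \<in> C}"
  shows "compact (closed_subgroup hull {a})"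
proof -
  obtain U V :: "'a set" where UV: "open U" "compact V" "0 \<in> U" "U \<subseteq> V"
    using bspec[OF lc[unfolded locally_compact_space_def], of 0]
    by (auto simp: compactin_euclidean_iff)
  obtain W where W: "open W" "0 \<in> W"
      "\<And>x y. x \<in> W \<Longrightarrow> y \<in> W \<Longrightarrow> x + y \<in> U \<and> - x + y \<in> U"
    by (rule zero_neighbourhood_shrink[OF UV(1,3)]) blast
  \<comment> \<open>The cyclic group generated by \<open>a\<close>; since \<open>nmult\<close> only
    takes natural multiples, its elements are written as differences.\<close>
  define P where "P = range (\<lambda>(i, j). nmult i a - nmult j a)"
  have PI: "nmult i a - nmult j a \<in> P" for i j
    by (auto simp: P_def)
  have near: "\<exists>i j. nmult j a - nmult i a + h \<in> W" if h: "h \<in> closure P" for h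
  proof -
    have "open ((\<lambda>y. - y + h) -` W)"
      using W(1) by (intro open_vimage continuous_intros)
    moreover have "h \<in> (\<lambda>y. - y + h) -` W"
      using W(2) by simp
    ultimately have "((\<lambda>y. - y + h) -` W) \<inter> P \<noteq> {}"
      using h closure_iff_nhds_not_empty by blast
    then show ?thesis
      by (auto simp: P_def)
  qed
  \<comment> \<open>Multiples of \<open>a\<close> return to \<open>W\<close> with arbitrarily large
    index. One with \<open>n > i\<close> turns the possibly negative exponent \<open>j - i\<close>
    into the natural number \<open>n + j - i\<close>, at the cost of enlarging \<open>W\<close> to
    \<open>U\<close>.\<close>
  have up: "\<exists>k. nmult k a + h \<in> U" if h: "h \<in> closure P" for h
  proof -
    obtain i j where ij: "nmult j a - nmult i a + h \<in> W"
      using near[OF h] by auto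
    obtain n where n: "n > i" "nmult n a \<in> W"
      using recurrent_multiples[OF C inf W(1,2)] by blast
    have "nmult (n + j - i) a + h = nmult n a + (nmult j a - nmult i a + h)"
      using n(1) neg_nmult_add_nmult[of i "n + j" a] nmult_diff_commute[of "n + j" a i]
      by (simp add: nmult_add add.assoc[symmetric] add_diff_eq)
    then show ?thesis
      using W(3)[OF n(2) ij] by (intro exI[of _ "n + j - i"]) simp
  qed
  \<comment> \<open>The same in the opposite direction. Here \<open>n > j\<close> makes the step
    \<open>n + i - j\<close> at least 1, and this positivity is what later contradicts
    minimality.\<close>
  have down: "\<exists>k\<in>{1..}. - nmult k a + h \<in> U" if h: "h \<in> closure P" for h
  proof -
    obtain i j where ij: "nmult j a - nmult i a + h \<in> W"
      using near[OF h] by auto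
    obtain n where n: "n > j" "nmult n a \<in> W"
      using recurrent_multiples[OF C inf W(1,2)] by blast
    have "- nmult (n + i - j) a = - (- nmult j a + nmult (n + i) a)"
      using n(1) neg_nmult_add_nmult[of j "n + i" a] by simp
    also have "\<dots> = - nmult (n + i) a + nmult j a"
      by (simp add: minus_add)
    also have "\<dots> = - nmult n a + (- nmult i a + nmult j a)"
      by (subst add.commute[of n]) (simp only: nmult_add minus_add add.assoc)
    also have "\<dots> = - nmult n a + (nmult j a - nmult i a)"
      by (simp only: nmult_diff_commute)
    finally have "- nmult (n + i - j) a + h = - nmult n a + (nmult j a - nmult i a + h)"
      by (simp only: add.assoc)
    then show ?thesis
      using W(3)[OF n(2) ij] n(1) by (intro bexI[of _ "n + i - j"]) auto
  qed
  have "compact (V \<inter> closure P)"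
    using UV(2) by (intro compact_Int_closed) auto
  moreover have "open ((\<lambda>h. - nmult k a + h) -` U)" for k
    using UV(1) by (intro open_vimage continuous_intros)
  moreover have "V \<inter> closure P \<subseteq> (\<Union>k\<in>{1..}. (\<lambda>h. - nmult k a + h) -` U)"
    using down by blast
  ultimately obtain F where F: "F \<subseteq> {1..}" "finite F"
      "V \<inter> closure P \<subseteq> (\<Union>k\<in>F. (\<lambda>h. - nmult k a + h) -` U)"
    using compactE_image[of "V \<inter> closure P" "{1..}" "\<lambda>k. (\<lambda>h. - nmult k a + h) -` U"] by metis
  define N where "N = Max (insert 0 F)"
  define L where "L = (\<Union>n\<le>N. (\<lambda>v. - nmult n a + v) ` V)"
  have "compact L"
    unfolding L_def using UV(2)
    by (intro compact_UN compact_continuous_image continuous_intros) auto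
  have "q \<in> L" if q: "q \<in> P" for q
  proof -
    obtain k where k: "nmult k a + q \<in> U"
      using up q closure_subset by blast
    \<comment> \<open>The first forward step that takes \<open>q\<close> into \<open>U\<close>. From
      the point reached, some step \<open>m \<in> F\<close> back stays in \<open>U\<close>; were
      \<open>m \<le> n\<close>, then \<open>n - m\<close> would be an earlier entry. Hence
      \<open>n < m \<le> N\<close>, uniformly in \<open>q\<close>.\<close>
    define n where "n = (LEAST n. nmult n a + q \<in> U)"
    have n: "nmult n a + q \<in> U"
      unfolding n_def using k by (rule LeastI)
    obtain i j where q': "q = nmult i a - nmult j a"
      using q by (auto simp: P_def)
    have "nmult n a + q \<in> P"
      unfolding q' using PI[of "n + i" j] by (simp add: nmult_add add_diff_eq)
    then obtain m where m: "m \<in> F" "- nmult m a + (nmult n a + q) \<in> U"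
      using F(3) n UV(4) closure_subset[of P] by blast
    have "n < m"
    proof (rule ccontr)
      assume "\<not> n < m"
      then have "m \<le> n" by simp
      then have "nmult (n - m) a + q \<in> U"
        using m(2) by (simp add: neg_nmult_add_nmult[symmetric] add.assoc)
      then have "n \<le> n - m"
        unfolding n_def by (rule Least_le)
      then show False
        using m(1) F(1) \<open>m \<le> n\<close> by auto
    qed
    moreover have "m \<le> N"
      unfolding N_def using m(1) F(2) by (intro Max_ge) auto
    moreover have "q \<in> (\<lambda>v. - nmult n a + v) ` V"
      using n UV(4) by (intro image_eqI[of _ _ "nmult n a + q"]) (auto simp: add.assoc[symmetric])
    ultimately show "q \<in> L"
      unfolding L_def by (intro UN_I[of n]) auto
  qed
  then have "closure P \<subseteq> L"
    using \<open>compact L\<close> by (intro closure_minimal compact_imp_closed) auto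
  moreover have "closed_subgroup (closure P)"
  proof (rule closed_subgroup_closure)
    show "0 \<in> P" using PI[of 0 0] by simp
    show "- x \<in> P" if x: "x \<in> P" for x
    proof -
      obtain i j where "x = nmult i a - nmult j a"
        using x by (auto simp: P_def)
      then show ?thesis
        using PI[of j i] by simp
    qed
    show "x + y \<in> P" if P: "x \<in> P" "y \<in> P" for x y
    proof -
      obtain i j k l where xy: "x = nmult i a - nmult j a" "y = nmult k a - nmult l a"
        using P by (auto simp: P_def)
      have "x + y = nmult i a + (- nmult j a + nmult k a) - nmult l a"
        unfolding xy by (simp only: diff_conv_add_uminus add.assoc)
      also have "\<dots> = nmult (i + k) a - nmult (l + j) a"
        unfolding nmult_diff_commute[of k a j, symmetric]
        by (simp only: nmult_add diff_conv_add_uminus minus_add add.assoc)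
      finally show ?thesis using PI by simp
    qed
  qed
  moreover have "a \<in> P"
    using PI[of 1 0] by simp
  then have "{a} \<subseteq> closure P"
    using closure_subset by auto
  ultimately have "closed_subgroup hull {a} \<subseteq> L"
    using hull_minimal by blast
  then show ?thesis
    using \<open>compact L\<close> closed_hull_closed_subgroup[of "{a}"] compact_Int_closed[of L "closed_subgroup hull {a}"]
    by (simp add: Int_absorb1)
qed

text \<open>If \<open>x\<close> and \<open>x + nmult n a\<close> both lie in \<open>K\<close>, then
  \<open>nmult n a\<close> lies in the compact set of differences \<open>- x + y\<close> with
  \<open>x, y \<in> K\<close>. By Weil's argument an aperiodic element does this for only finitely
  many \<open>n\<close>.\<close>

lemma aperiodic_eventually_disjoint:
  fixes a :: "'a::{topological_group_add, t2_space}"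
  assumes "locally_compact_space (euclidean :: 'a topology)" "aperiodic a" and K: "compact K"
  shows "\<forall>\<^sub>F n in sequentially. \<forall>x\<in>K. x + nmult n a \<notin> K \<and> x - nmult n a \<notin> K"
proof -
  define C where "C = (\<lambda>p. - fst p + snd p) ` (K \<times> K)"
  have "compact C"
    unfolding C_def using K by (intro compact_continuous_image continuous_intros compact_Times)
  then have "finite {n. nmult n a \<in> C}"
    using assms compact_hull_if_recurrent unfolding aperiodic_def by blast
  then have "\<forall>\<^sub>F n in sequentially. nmult n a \<notin> C"
    by (simp add: cofinite_eq_sequentially[symmetric] eventually_cofinite)
  then show ?thesis
  proof eventually_elim
    case (elim n)
    have *: "x + nmult n a \<notin> K" if "x \<in> K" for x
    proof
      assume "x + nmult n a \<in> K"
      then have "- x + (x + nmult n a) \<in> C"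
        unfolding C_def using that by (intro image_eqI[of _ _ "(x, x + nmult n a)"]) auto
      then show False using elim by (simp add: add.assoc[symmetric])
    qed
    \<comment> \<open>The backward half is the forward half applied to the point
      \<open>x - nmult n a\<close>.\<close>
    then show ?case
      by (metis diff_add_cancel)
  qed
qed

section \<open>Auxiliary limits and exhaustions\<close>

text \<open>Reduces convergence to nonstrict bounds by real constants, the form in which essential
  suprema translate into almost everywhere statements.\<close>

lemma tendsto_0_ennreal_iff:
  fixes f :: "'b \<Rightarrow> ennreal"
  shows "(f \<longlongrightarrow> 0) F \<longleftrightarrow> (\<forall>c>0. \<forall>\<^sub>F x in F. f x \<le> ennreal c)"
proof
  assume f: "(f \<longlongrightarrow> 0) F"
  show "\<forall>c>0. \<forall>\<^sub>F x in F. f x \<le> ennreal c"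
  proof (intro allI impI)
    fix c :: real assume "c > 0"
    then have "\<forall>\<^sub>F x in F. f x < ennreal c"
      by (intro order_tendstoD(2)[OF f]) simp
    then show "\<forall>\<^sub>F x in F. f x \<le> ennreal c"
      by eventually_elim simp
  qed
next
  assume *: "\<forall>c>0. \<forall>\<^sub>F x in F. f x \<le> ennreal c"
  show "(f \<longlongrightarrow> 0) F"
  proof (rule order_tendstoI)
    fix y :: ennreal assume "0 < y"
    then obtain z where z: "0 < z" "z < y"
      using dense by blast
    then obtain c where c: "z = ennreal c" "c \<ge> 0"
      by (cases z) auto
    then have "c > 0"
      using z by (simp add: less_le)
    then have "\<forall>\<^sub>F x in F. f x \<le> ennreal c"
      using * by blast
    then show "\<forall>\<^sub>F x in F. f x < y"
      by eventually_elim (use z c in auto)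
  qed simp
qed

text \<open>At stage \<open>n\<close> take a witness for the finest tolerance
  \<open>1 / (k + 1)\<close>, \<open>k \<le> n\<close>, that has one. Each fixed tolerance is
  eventually among the candidates, and monotonicity passes from the finest one to it.\<close>

lemma eventually_diagonal:
  fixes Q :: "real \<Rightarrow> nat \<Rightarrow> 'b \<Rightarrow> bool"
  assumes Q: "\<And>c. c > 0 \<Longrightarrow> \<forall>\<^sub>F n in sequentially. \<exists>x. Q c n x"
    and mono: "\<And>c d n x. 0 < c \<Longrightarrow> c \<le> d \<Longrightarrow> Q c n x \<Longrightarrow> Q d n x"
  obtains x where "\<And>c. c > 0 \<Longrightarrow> \<forall>\<^sub>F n in sequentially. Q c n (x n)"
proof -
  \<comment> \<open>The bound \<open>k \<le> n\<close> keeps the set finite, so that its maximum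
    exists whenever it is nonempty; the remaining \<open>n\<close> get an arbitrary
    \<open>x n\<close>.\<close>
  define S where "S n = {k. k \<le> n \<and> (\<exists>x. Q (1 / real (Suc k)) n x)}" for n
  have fin: "finite (S n)" for n
    by (rule finite_subset[of _ "{..n}"]) (auto simp: S_def)
  define x where "x n = (SOME x. Q (1 / real (Suc (Max (S n)))) n x)" for n
  have "\<forall>\<^sub>F n in sequentially. Q c n (x n)" if "c > 0" for c
  proof -
    obtain k where k: "1 / real (Suc k) < c"
      using nat_approx_posE[OF \<open>c > 0\<close>] by blast
    have "\<forall>\<^sub>F n in sequentially. \<exists>x. Q (1 / real (Suc k)) n x"
      by (rule Q) simp
    then show ?thesis
      using eventually_ge_at_top[of k]
    proof eventually_elim
      case (elim n)
      then have kS: "k \<in> S n"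
        by (simp add: S_def)
      then have "Max (S n) \<in> S n"
        using fin by (intro Max_in) auto
      then have "\<exists>x. Q (1 / real (Suc (Max (S n)))) n x"
        by (simp add: S_def)
      then have "Q (1 / real (Suc (Max (S n)))) n (x n)"
        unfolding x_def by (rule someI_ex)
      moreover have "1 / real (Suc (Max (S n))) \<le> 1 / real (Suc k)"
        using Max_ge[OF fin kS] by (simp add: frac_le)
      ultimately show ?case
        using mono[of "1 / real (Suc (Max (S n)))" c] k by simp
    qed
  qed
  then show thesis
    by (rule that)
qed

text \<open>The open sets contained in compact ones cover the space, and by the Lindelof property
  countably many suffice; finite unions of their compact supersets exhaust the space.\<close>

lemma locally_compact_exhaustion:
  assumes lc: "locally_compact_space (euclidean :: 'a::second_countable_topology topology)"
  obtains K :: "nat \<Rightarrow> 'a::second_countable_topology set" where "\<And>n. compact (K n)" "incseq K" "(\<Union>n. K n) = UNIV"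
proof -
  define F where "F = {U :: 'a set. open U \<and> (\<exists>K. compact K \<and> U \<subseteq> K)}"
  have UF: "\<Union>F = UNIV"
  proof (intro equalityI subset_UNIV subsetI)
    fix x :: 'a
    show "x \<in> \<Union>F"
      using bspec[OF lc[unfolded locally_compact_space_def], of x]
      by (auto simp: compactin_euclidean_iff F_def)
  qed
  obtain F' where F': "F' \<subseteq> F" "countable F'" "\<Union>F' = \<Union>F"
    by (rule Lindelof[of F]) (auto simp: F_def)
  have "F' \<noteq> {}"
    using F'(3) UF by auto
  have "\<forall>U\<in>F. \<exists>C. compact C \<and> U \<subseteq> C"
    by (simp add: F_def)
  from bchoice[OF this] obtain C where C: "\<forall>U\<in>F. compact (C U) \<and> U \<subseteq> C U" ..
  define K where "K n = (\<Union>i\<le>n. C (from_nat_into F' i))" for n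
  have F: "from_nat_into F' i \<in> F" for i
    using from_nat_into[OF \<open>F' \<noteq> {}\<close>] F'(1) by blast
  have CF: "compact (C (from_nat_into F' i))" "from_nat_into F' i \<subseteq> C (from_nat_into F' i)" for i
    using bspec[OF C F, of i] by auto
  show thesis
  proof
    show "compact (K n)" for n
      unfolding K_def by (intro compact_UN finite_atMost ballI CF)
    show "incseq K"
    proof (rule monoI)
      fix m n :: nat assume "m \<le> n"
      then show "K m \<subseteq> K n" unfolding K_def by fastforce
    qed
    have "\<exists>n. x \<in> K n" for x
    proof -
      have "x \<in> \<Union>F'"
        using F'(3) UF by simp
      then obtain i where "x \<in> from_nat_into F' i"
        using from_nat_into_surj[OF F'(2)] by blast
      then have "x \<in> K i"
        unfolding K_def using CF(2)[of i] by auto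
      then show ?thesis ..
    qed
    then show "(\<Union>n. K n) = UNIV"
      by auto
  qed
qed

section \<open>Weighted translations\<close>

locale weighted_orlicz =
  fixes \<mu> :: "'a::{topological_group_add, t2_space, second_countable_topology} measure"
    and a :: 'a and w :: "'a \<Rightarrow> real" and \<Phi> :: "real \<Rightarrow> real"
  assumes haar: "right_haar_measure \<mu>"
    and weight: "weight w"
    and young: "young_function \<Phi>"
begin

lemma sets_haar [measurable_cong]: "sets \<mu> = sets borel"
  using haar by (simp add: right_haar_measure_def)

lemma space_haar [simp]: "space \<mu> = UNIV"
  using sets_eq_imp_space_eq[OF sets_haar] by simp

lemma translation_measurable [measurable]: "(\<lambda>x. x + b) \<in> measurable \<mu> \<mu>"
  using right_haar_distr(1)[OF haar, of "- b"] by simp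

lemma translation_measurable' [measurable]: "(\<lambda>x. x - b) \<in> measurable \<mu> \<mu>"
  by (rule right_haar_distr(1)[OF haar])

lemma young_borel [measurable]: "\<Phi> \<in> borel_measurable borel"
  by (rule young_measurable[OF young])

lemma weight_pos: "w x > 0"
  using weight by (simp add: weight_def)

lemma weight_borel [measurable]: "w \<in> borel_measurable \<mu>"
proof -
  have "w \<in> borel_measurable borel"
    using weight by (auto simp: weight_def intro: borel_measurable_continuous_onI)
  then show ?thesis by measurable
qed

lemma weight_prod_pos: "weight_prod a w n x > 0"
  unfolding weight_prod_def by (intro prod_pos) (simp add: weight_pos)

lemma weight_prod_tilde_pos: "weight_prod_tilde a w n x > 0"
  unfolding weight_prod_tilde_def by (intro positive_imp_inverse_positive prod_pos) (simp add: weight_pos)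

lemma weight_prod_borel [measurable]: "weight_prod a w n \<in> borel_measurable \<mu>"
  unfolding weight_prod_def by measurable

lemma weight_prod_tilde_borel [measurable]: "weight_prod_tilde a w n \<in> borel_measurable \<mu>"
  unfolding weight_prod_tilde_def by measurable

lemma nn_integral_translation:
  assumes [measurable]: "f \<in> borel_measurable \<mu>"
  shows "(\<integral>\<^sup>+x. f (x - b) \<partial>\<mu>) = (\<integral>\<^sup>+x. f x \<partial>\<mu>)"
proof -
  have "(\<integral>\<^sup>+x. f (x - b) \<partial>\<mu>) = (\<integral>\<^sup>+x. f x \<partial>distr \<mu> \<mu> (\<lambda>x. x - b))"
    by (rule nn_integral_distr[symmetric]) measurable
  then show ?thesis
    by (simp add: right_haar_distr(2)[OF haar])
qed

lemma emeasure_translation_vimage: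
  assumes [measurable]: "A \<in> sets \<mu>"
  shows "emeasure \<mu> {x. x + b \<in> A} = emeasure \<mu> A"
proof -
  have "emeasure \<mu> {x. x + b \<in> A} = emeasure (distr \<mu> \<mu> (\<lambda>x. x - (- b))) A"
    by (subst emeasure_distr) (auto simp: vimage_def)
  then show ?thesis
    by (simp only: right_haar_distr(2)[OF haar])
qed

lemma nmult_Suc_right: "nmult (Suc n) b = nmult n b + b"
  using nmult_add[of n 1 b] by simp

text \<open>Iteration collects the weights at \<open>x\<close>, \<open>x - a\<close>, ...,
  \<open>x - nmult (n - 1) a\<close>, whose product is the reciprocal of
  \<open>weight_prod_tilde\<close>.\<close>

lemma translate_fun_funpow:
  "(translate_fun a w ^^ n) f x = of_real (inverse (weight_prod_tilde a w n x)) * f (x - nmult n a)"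
proof (induction n arbitrary: x)
  case 0
  show ?case by (simp add: weight_prod_tilde_def)
next
  case (Suc n)
  \<comment> \<open>Negation reverses the order of summands, so the new \<open>a\<close> has to be
    split off on the right of the multiple.\<close>
  have *: "x - a - nmult j a = x - nmult (Suc j) a" for j
    by (simp only: nmult_Suc_right diff_conv_add_uminus minus_add add.assoc)
  show ?case
    using Suc[of "x - a"] unfolding *
    by (simp add: translate_fun_def weight_prod_tilde_def * prod.lessThan_Suc_shift del: nmult.simps(2) prod.lessThan_Suc)
qed

text \<open>Links the two products: the weights met on the way back from
  \<open>x + nmult n a\<close> to \<open>x + a\<close> are those of \<open>weight_prod\<close>, in
  reverse order.\<close>

lemma inverse_weight_prod_tilde_translate:
  "inverse (weight_prod_tilde a w n (x + nmult n a)) = weight_prod a w n x"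
proof -
  have *: "x + nmult n a - nmult j a = x + nmult (n - j) a" if "j < n" for j
    using nmult_add[of "n - j" j a] that by (simp add: add_diff_eq[symmetric])
  have "inverse (weight_prod_tilde a w n (x + nmult n a)) = (\<Prod>j<n. w (x + nmult (n - j) a))"
    unfolding weight_prod_tilde_def inverse_inverse_eq by (intro prod.cong) (auto simp: *)
  also have "\<dots> = (\<Prod>i<n. w (x + nmult (Suc i) a))"
    by (subst prod.nat_diff_reindex[symmetric]) (auto intro!: prod.cong simp: Suc_diff_Suc simp del: nmult.simps)
  also have "\<dots> = weight_prod a w n x"
    unfolding weight_prod_def by (simp add: prod.atLeast1_atMost_eq del: nmult.simps)
  finally show ?thesis .
qed

lemma translate_fun_funpow_orlicz:
  "f \<in> orlicz_functions \<mu> \<Phi> \<Longrightarrow> (translate_fun a w ^^ n) f \<in> orlicz_functions \<mu> \<Phi>"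
  by (induction n) (auto intro: translate_fun_orlicz[OF haar young weight])

lemma weighted_translation_funpow_class:
  assumes "f \<in> orlicz_functions \<mu> \<Phi>"
  shows "(weighted_translation \<mu> \<Phi> a w ^^ n) (orlicz_class \<mu> \<Phi> f)
    = orlicz_class \<mu> \<Phi> ((translate_fun a w ^^ n) f)"
  by (induction n)
    (auto simp: weighted_translation_class[OF haar young weight translate_fun_funpow_orlicz[OF assms]])

section \<open>Mixing expressed by functions and the Luxemburg norm\<close>

sublocale orlicz: Metric_space "orlicz_space \<mu> \<Phi>" "orlicz_dist \<mu> \<Phi>"
  by (rule orlicz_Metric_space[OF young])

lemma orlicz_class_in_space: "f \<in> orlicz_functions \<mu> \<Phi> \<Longrightarrow> orlicz_class \<mu> \<Phi> f \<in> orlicz_space \<mu> \<Phi>"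
  by (simp add: orlicz_space_def)

text \<open>Nonempty open sets may be replaced by balls around classes, and distances and iterates
  of classes can be computed on any representatives.\<close>

lemma topologically_mixing_iff:
  "topologically_mixing (orlicz_topology \<mu> \<Phi>) (weighted_translation \<mu> \<Phi> a w) \<longleftrightarrow>
    (\<forall>f\<in>orlicz_functions \<mu> \<Phi>. \<forall>g\<in>orlicz_functions \<mu> \<Phi>. \<forall>\<epsilon>>0. \<forall>\<^sub>F n in sequentially.
      \<exists>h\<in>orlicz_functions \<mu> \<Phi>. luxemburg_norm \<mu> \<Phi> (\<lambda>x. f x - h x) < \<epsilon> \<and>
        luxemburg_norm \<mu> \<Phi> (\<lambda>x. g x - (translate_fun a w ^^ n) h x) < \<epsilon>)" (is "?L \<longleftrightarrow> ?R")
proof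
  assume L: ?L
  show ?R
  proof (intro ballI allI impI)
    fix f g and \<epsilon> :: real
    assume f: "f \<in> orlicz_functions \<mu> \<Phi>" and g: "g \<in> orlicz_functions \<mu> \<Phi>" and e: "\<epsilon> > 0"
    let ?U = "\<lambda>f. orlicz.mball (orlicz_class \<mu> \<Phi> f) \<epsilon>"
    have U: "openin (orlicz_topology \<mu> \<Phi>) (?U f)" "?U f \<noteq> {}" if "f \<in> orlicz_functions \<mu> \<Phi>" for f
      using orlicz_class_in_space[OF that] e
      by (simp_all add: orlicz_topology_def orlicz.openin_mball orlicz.mball_eq_empty)
    obtain N where N: "\<And>n. n \<ge> N \<Longrightarrow> (weighted_translation \<mu> \<Phi> a w ^^ n) ` ?U f \<inter> ?U g \<noteq> {}"
      using L U[OF f] U[OF g] unfolding topologically_mixing_def by metis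
    show "\<forall>\<^sub>F n in sequentially.
      \<exists>h\<in>orlicz_functions \<mu> \<Phi>. luxemburg_norm \<mu> \<Phi> (\<lambda>x. f x - h x) < \<epsilon> \<and>
        luxemburg_norm \<mu> \<Phi> (\<lambda>x. g x - (translate_fun a w ^^ n) h x) < \<epsilon>"
      unfolding eventually_sequentially
    proof (intro exI allI impI)
      fix n assume "N \<le> n"
      then obtain C where C: "C \<in> ?U f" "(weighted_translation \<mu> \<Phi> a w ^^ n) C \<in> ?U g"
        using N by blast
      then have "C \<in> orlicz_space \<mu> \<Phi>"
        by simp
      then obtain h where h: "h \<in> orlicz_functions \<mu> \<Phi>" "C = orlicz_class \<mu> \<Phi> h"
        by (auto simp: orlicz_space_def)
      show "\<exists>h\<in>orlicz_functions \<mu> \<Phi>. luxemburg_norm \<mu> \<Phi> (\<lambda>x. f x - h x) < \<epsilon> \<and>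
          luxemburg_norm \<mu> \<Phi> (\<lambda>x. g x - (translate_fun a w ^^ n) h x) < \<epsilon>"
        using C h f g translate_fun_funpow_orlicz[OF h(1)]
        by (intro bexI[of _ h]) (auto simp: weighted_translation_funpow_class orlicz_dist_class)
    qed
  qed
next
  assume R: ?R
  show ?L
    unfolding topologically_mixing_def
  proof (intro allI impI, elim conjE)
    fix U V assume U: "openin (orlicz_topology \<mu> \<Phi>) U" "U \<noteq> {}"
      and V: "openin (orlicz_topology \<mu> \<Phi>) V" "V \<noteq> {}"
    have ball: "\<exists>f\<in>orlicz_functions \<mu> \<Phi>. \<exists>r>0. orlicz.mball (orlicz_class \<mu> \<Phi> f) r \<subseteq> U"
      if "openin (orlicz_topology \<mu> \<Phi>) U" "U \<noteq> {}" for U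
    proof -
      obtain C where C: "C \<in> U"
        using \<open>U \<noteq> {}\<close> by blast
      have U': "U \<subseteq> orlicz_space \<mu> \<Phi>" "\<forall>C\<in>U. \<exists>r>0. orlicz.mball C r \<subseteq> U"
        using \<open>openin (orlicz_topology \<mu> \<Phi>) U\<close>
        unfolding orlicz_topology_def orlicz.openin_mtopology by blast+
      obtain r where "r > 0" "orlicz.mball C r \<subseteq> U"
        using U'(2) C by blast
      moreover have "C \<in> orlicz_space \<mu> \<Phi>"
        using U'(1) C by blast
      then obtain f where "f \<in> orlicz_functions \<mu> \<Phi>" "C = orlicz_class \<mu> \<Phi> f"
        by (auto simp: orlicz_space_def)
      ultimately show ?thesis
        by blast
    qed
    obtain f r where f: "f \<in> orlicz_functions \<mu> \<Phi>" "r > 0" "orlicz.mball (orlicz_class \<mu> \<Phi> f) r \<subseteq> U"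
      using ball[OF U] by blast
    obtain g s where g: "g \<in> orlicz_functions \<mu> \<Phi>" "s > 0" "orlicz.mball (orlicz_class \<mu> \<Phi> g) s \<subseteq> V"
      using ball[OF V] by blast
    \<comment> \<open>The right-hand side offers one tolerance for both approximations, so the
      smaller radius is used.\<close>
    have "min r s > 0"
      using f g by simp
    from R[rule_format, OF f(1) g(1) this] obtain N where N: "\<And>n. n \<ge> N \<Longrightarrow>
      \<exists>h\<in>orlicz_functions \<mu> \<Phi>. luxemburg_norm \<mu> \<Phi> (\<lambda>x. f x - h x) < min r s \<and>
        luxemburg_norm \<mu> \<Phi> (\<lambda>x. g x - (translate_fun a w ^^ n) h x) < min r s"
      unfolding eventually_sequentially by blast
    show "\<exists>N. \<forall>n\<ge>N. (weighted_translation \<mu> \<Phi> a w ^^ n) ` U \<inter> V \<noteq> {}"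
    proof (intro exI allI impI)
      fix n assume "N \<le> n"
      then obtain h where h: "h \<in> orlicz_functions \<mu> \<Phi>"
        "luxemburg_norm \<mu> \<Phi> (\<lambda>x. f x - h x) < min r s"
        "luxemburg_norm \<mu> \<Phi> (\<lambda>x. g x - (translate_fun a w ^^ n) h x) < min r s"
        using N by blast
      note T = translate_fun_funpow_orlicz[OF h(1), of n]
      have "orlicz_class \<mu> \<Phi> h \<in> U"
        using f h by (intro subsetD[OF f(3)]) (auto simp: orlicz_dist_class orlicz_class_in_space)
      moreover have "orlicz_class \<mu> \<Phi> ((translate_fun a w ^^ n) h) \<in> V"
        using g h T by (intro subsetD[OF g(3)]) (auto simp: orlicz_dist_class orlicz_class_in_space)
      ultimately show "(weighted_translation \<mu> \<Phi> a w ^^ n) ` U \<inter> V \<noteq> {}"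
        using weighted_translation_funpow_class[OF h(1), of n] by auto
    qed
  qed
qed

section \<open>Sets on which the weights are small\<close>

lemma compact_sets [measurable]: "compact K \<Longrightarrow> K \<in> sets \<mu>"
  using compact_imp_closed[of K] by (simp add: sets_haar)

lemma compact_finite: "compact K \<Longrightarrow> emeasure \<mu> K < \<infinity>"
  using haar by (auto simp: right_haar_measure_def)

text \<open>Condition (ii) at a single stage \<open>n\<close>, with one tolerance \<open>c\<close>
  for the lost measure and for both weights. The bounds hold only almost everywhere because the
  essential supremum ignores null sets.\<close>

definition small_weight_set :: "'a set \<Rightarrow> real \<Rightarrow> nat \<Rightarrow> 'a set \<Rightarrow> bool" where
  "small_weight_set K c n E \<longleftrightarrow>
     E \<in> sets borel \<and> E \<subseteq> K \<and> emeasure \<mu> (K - E) \<le> ennreal c \<and>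
     (AE x in \<mu>. x \<in> E \<longrightarrow> weight_prod a w n x \<le> c \<and> weight_prod_tilde a w n x \<le> c)"

lemma small_weight_set_mono:
  assumes "c \<le> d" "small_weight_set K c n E"
  shows "small_weight_set K d n E"
proof -
  have "ennreal c \<le> ennreal d"
    using assms(1) by (rule ennreal_leI)
  with assms show ?thesis
    unfolding small_weight_set_def by (auto elim!: eventually_mono)
qed

text \<open>A function is almost everywhere at most its essential supremum, which is also the least
  such bound; positivity removes the absolute value.\<close>

lemma linfty_norm_restrict_le_iff:
  assumes E: "E \<in> sets \<mu>" and u[measurable]: "u \<in> borel_measurable \<mu>" and pos: "\<And>x. u x > 0" and c: "c > 0"
  shows "linfty_norm (restrict_space \<mu> E) u \<le> ennreal c \<longleftrightarrow> (AE x in \<mu>. x \<in> E \<longrightarrow> u x \<le> c)"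
proof -
  have m: "(\<lambda>x. ennreal \<bar>u x\<bar>) \<in> borel_measurable (restrict_space \<mu> E)"
    by (intro measurable_restrict_space1) measurable
  have "linfty_norm (restrict_space \<mu> E) u \<le> ennreal c \<longleftrightarrow>
      (AE x in restrict_space \<mu> E. ennreal \<bar>u x\<bar> \<le> ennreal c)"
    unfolding linfty_norm_def using esssup_I[OF m] esssup_AE[of "\<lambda>x. ennreal \<bar>u x\<bar>" "restrict_space \<mu> E"]
    by (auto elim!: eventually_mono)
  also have "\<dots> \<longleftrightarrow> (AE x in \<mu>. x \<in> E \<longrightarrow> u x \<le> c)"
    using E c pos by (subst AE_restrict_space_iff) (auto simp: abs_of_pos)
  finally show ?thesis .
qed

text \<open>Forwards, the finite measure of \<open>K\<close> turns convergence of measures into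
  small complements. Backwards, sets for separate tolerances are merged into one sequence by the
  diagonal choice.\<close>

lemma vanishing_weights_iff:
  assumes K: "compact K"
  shows "(\<exists>E :: nat \<Rightarrow> 'a set.
        (\<forall>n\<ge>1. E n \<in> sets borel \<and> E n \<subseteq> K) \<and>
        (\<lambda>n. emeasure \<mu> (E n)) \<longlonglongrightarrow> emeasure \<mu> K \<and>
        (\<lambda>n. linfty_norm (restrict_space \<mu> (E n)) (weight_prod a w n)) \<longlonglongrightarrow> 0 \<and>
        (\<lambda>n. linfty_norm (restrict_space \<mu> (E n)) (weight_prod_tilde a w n)) \<longlonglongrightarrow> 0) \<longleftrightarrow>
    (\<forall>c>0. \<forall>\<^sub>F n in sequentially. \<exists>E. small_weight_set K c n E)" (is "?L \<longleftrightarrow> ?R")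
proof
  assume ?L
  then obtain E where E: "\<And>n. n \<ge> 1 \<Longrightarrow> E n \<in> sets \<mu> \<and> E n \<subseteq> K"
    "(\<lambda>n. emeasure \<mu> (E n)) \<longlonglongrightarrow> emeasure \<mu> K"
    "(\<lambda>n. linfty_norm (restrict_space \<mu> (E n)) (weight_prod a w n)) \<longlonglongrightarrow> 0"
    "(\<lambda>n. linfty_norm (restrict_space \<mu> (E n)) (weight_prod_tilde a w n)) \<longlonglongrightarrow> 0"
    by (auto simp: sets_haar)
  have "(\<lambda>n. emeasure \<mu> K - emeasure \<mu> (E n)) \<longlonglongrightarrow> emeasure \<mu> K - emeasure \<mu> K"
    using compact_finite[OF K] by (intro tendsto_diff_ennreal tendsto_const E(2)) auto
  then have E0: "(\<lambda>n. emeasure \<mu> K - emeasure \<mu> (E n)) \<longlonglongrightarrow> 0"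
    using compact_finite[OF K] by (simp add: ennreal_diff_self)
  show ?R
  proof (intro allI impI)
    fix c :: real assume c: "c > 0"
    note ev = E0[unfolded tendsto_0_ennreal_iff, rule_format, OF c]
      E(3)[unfolded tendsto_0_ennreal_iff, rule_format, OF c]
      E(4)[unfolded tendsto_0_ennreal_iff, rule_format, OF c]
    show "\<forall>\<^sub>F n in sequentially. \<exists>E. small_weight_set K c n E"
      using ev eventually_ge_at_top[of 1]
    proof eventually_elim
      case (elim n)
      note En = E(1)[OF elim(4)]
      have "emeasure \<mu> (E n) \<noteq> \<infinity>"
        using emeasure_mono[of "E n" K \<mu>] En compact_finite[OF K] compact_sets[OF K] by (auto simp: top_unique)
      then have "emeasure \<mu> (K - E n) \<le> ennreal c"
        using elim(1) En compact_sets[OF K] by (simp add: emeasure_Diff)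
      moreover have "AE x in \<mu>. x \<in> E n \<longrightarrow> weight_prod a w n x \<le> c"
        using elim(2) En c by (subst linfty_norm_restrict_le_iff[symmetric]) (auto simp: weight_prod_pos)
      moreover have "AE x in \<mu>. x \<in> E n \<longrightarrow> weight_prod_tilde a w n x \<le> c"
        using elim(3) En c by (subst linfty_norm_restrict_le_iff[symmetric]) (auto simp: weight_prod_tilde_pos)
      ultimately have "small_weight_set K c n (E n)"
        using En unfolding small_weight_set_def sets_haar by auto
      then show ?case ..
    qed
  qed
next
  assume R: ?R
  obtain E where E: "\<And>c. c > 0 \<Longrightarrow> \<forall>\<^sub>F n in sequentially. small_weight_set K c n (E n)"
    by (rule eventually_diagonal[of "small_weight_set K"]) (use R small_weight_set_mono in auto)
  \<comment> \<open>The diagonal sets are only controlled eventually; the empty set replaces the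
    others that are not Borel subsets of \<open>K\<close>.\<close>
  define E' where "E' n = (if E n \<in> sets borel \<and> E n \<subseteq> K then E n else {})" for n
  have E'K: "E' n \<in> sets borel" "E' n \<subseteq> K" for n
    by (auto simp: E'_def)
  have E': "\<forall>\<^sub>F n in sequentially. small_weight_set K c n (E' n)" if "c > 0" for c
    using E[OF that] by eventually_elim (simp add: E'_def small_weight_set_def)
  have "(\<lambda>n. emeasure \<mu> (K - E' n)) \<longlonglongrightarrow> 0"
    unfolding tendsto_0_ennreal_iff
  proof (intro allI impI)
    fix c :: real assume c: "c > 0"
    show "\<forall>\<^sub>F n in sequentially. emeasure \<mu> (K - E' n) \<le> ennreal c"
      using E'[OF c] by eventually_elim (simp add: small_weight_set_def)
  qed
  then have "(\<lambda>n. emeasure \<mu> K - emeasure \<mu> (K - E' n)) \<longlonglongrightarrow> emeasure \<mu> K - 0"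
    using compact_finite[OF K] by (intro tendsto_diff_ennreal tendsto_const) auto
  moreover have "emeasure \<mu> K - emeasure \<mu> (K - E' n) = emeasure \<mu> (E' n)" for n
  proof -
    have "emeasure \<mu> (K - E' n) \<noteq> \<infinity>"
      using emeasure_mono[of "K - E' n" K \<mu>] compact_finite[OF K] compact_sets[OF K] by (auto simp: top_unique)
    then have "emeasure \<mu> K - emeasure \<mu> (K - E' n) = emeasure \<mu> (K - (K - E' n))"
      using compact_sets[OF K] E'K[of n] by (intro emeasure_Diff[symmetric]) (auto simp: sets_haar)
    also have "K - (K - E' n) = E' n"
      using E'K(2) by auto
    finally show ?thesis .
  qed
  moreover have "(\<lambda>n. linfty_norm (restrict_space \<mu> (E' n)) (weight_prod a w n)) \<longlonglongrightarrow> 0"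
    unfolding tendsto_0_ennreal_iff
  proof (intro allI impI)
    fix c :: real assume c: "c > 0"
    show "\<forall>\<^sub>F n in sequentially. linfty_norm (restrict_space \<mu> (E' n)) (weight_prod a w n) \<le> ennreal c"
      using E'[OF c]
      by eventually_elim
        (use E'K c in \<open>auto simp: linfty_norm_restrict_le_iff sets_haar weight_prod_pos small_weight_set_def\<close>)
  qed
  moreover have "(\<lambda>n. linfty_norm (restrict_space \<mu> (E' n)) (weight_prod_tilde a w n)) \<longlonglongrightarrow> 0"
    unfolding tendsto_0_ennreal_iff
  proof (intro allI impI)
    fix c :: real assume c: "c > 0"
    show "\<forall>\<^sub>F n in sequentially. linfty_norm (restrict_space \<mu> (E' n)) (weight_prod_tilde a w n) \<le> ennreal c"
      using E'[OF c]
      by eventually_elim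
        (use E'K c in \<open>auto simp: linfty_norm_restrict_le_iff sets_haar weight_prod_tilde_pos small_weight_set_def\<close>)
  qed
  ultimately show ?L
    using E'K by (intro exI[of _ E']) simp
qed

section \<open>Approximation in the Orlicz space\<close>

text \<open>The integrand is at most the constant \<Phi>(b / k) on \<open>A\<close>, by
  monotonicity, and vanishes off \<open>A\<close> because \<Phi>(0) = 0.\<close>

lemma modular_bounded:
  assumes A: "A \<in> sets \<mu>" and u: "AE x in \<mu>. norm (u x) \<le> b" "\<And>x. x \<notin> A \<Longrightarrow> u x = 0"
    and k: "k > 0" and b: "b \<ge> 0"
  shows "modular \<mu> \<Phi> u k \<le> ennreal (\<Phi> (b / k)) * emeasure \<mu> A"
proof -
  have "modular \<mu> \<Phi> u k \<le> (\<integral>\<^sup>+x. ennreal (\<Phi> (b / k)) * indicator A x \<partial>\<mu>)"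
  proof (rule nn_integral_mono_AE, use u(1) in eventually_elim)
    fix x assume x: "norm (u x) \<le> b"
    show "ennreal (\<Phi> (norm (u x) / k)) \<le> ennreal (\<Phi> (b / k)) * indicator A x"
    proof (cases "x \<in> A")
      case True
      have "\<Phi> (norm (u x) / k) \<le> \<Phi> (b / k)"
        using x k by (intro young_mono[OF young] divide_right_mono) auto
      then show ?thesis
        using True by (simp add: ennreal_leI)
    next
      case False
      then show ?thesis
        using u(2) young by (simp add: young_function_def)
    qed
  qed
  also have "\<dots> = ennreal (\<Phi> (b / k)) * emeasure \<mu> A"
    using A by (rule nn_integral_cmult_indicator)
  finally show ?thesis .
qed

lemma bounded_orlicz:
  assumes K: "compact K" and [measurable]: "u \<in> borel_measurable \<mu>"
    and u: "AE x in \<mu>. norm (u x) \<le> b" "\<And>x. x \<notin> K \<Longrightarrow> u x = 0" and b: "b \<ge> 0"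
  shows "u \<in> orlicz_functions \<mu> \<Phi>"
proof -
  have "modular \<mu> \<Phi> u 1 \<le> ennreal (\<Phi> (b / 1)) * emeasure \<mu> K"
    by (rule modular_bounded) (use u b K compact_sets in auto)
  also have "\<dots> < \<infinity>"
    using compact_finite[OF K] by (simp add: ennreal_mult_less_top)
  finally show ?thesis
    unfolding orlicz_functions_def by (auto intro!: exI[of _ 1])
qed

lemma delta2_power:
  assumes "M > 0" "\<forall>t>0. \<Phi> (2 * t) \<le> M * \<Phi> t" and t: "t \<ge> 0"
  shows "\<Phi> (2 ^ j * t) \<le> M ^ j * \<Phi> t"
proof (induction j)
  case (Suc j)
  have "\<Phi> (2 ^ Suc j * t) \<le> M * \<Phi> (2 ^ j * t)"
  \<comment> \<open>The doubling condition is only available for positive arguments; at 0 both sides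
    vanish.\<close>
  proof (cases "t = 0")
    case True
    then show ?thesis using young by (simp add: young_function_def)
  next
    case False
    then show ?thesis using assms(2)[rule_format, of "2 ^ j * t"] t by (simp add: mult.assoc)
  qed
  also have "\<dots> \<le> M * (M ^ j * \<Phi> t)"
    using Suc assms(1) by (intro mult_left_mono) auto
  finally show ?case by (simp add: mult.assoc)
qed simp

text \<open>The modular is finite at some scale \<open>l\<close>. Passing to \<open>k\<close>
  stretches arguments by \<open>l / k < 2 ^ j\<close>, which \<open>j\<close> doublings absorb into
  a factor \<open>M ^ j\<close>.\<close>

lemma orlicz_modular_finite:
  assumes M: "M > 0" "\<forall>t>0. \<Phi> (2 * t) \<le> M * \<Phi> t"
    and f: "f \<in> orlicz_functions \<mu> \<Phi>" and k: "k > 0"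
  shows "modular \<mu> \<Phi> f k < \<infinity>"
proof -
  have [measurable]: "f \<in> borel_measurable \<mu>"
    using f by (simp add: orlicz_functions_def)
  obtain l where l: "l > 0" "modular \<mu> \<Phi> f l \<le> 1"
    using modular_nonempty[OF young f] by blast
  obtain j where j: "l / k < 2 ^ j"
    using real_arch_pow[of 2 "l / k"] by auto
  have "modular \<mu> \<Phi> f k \<le> (\<integral>\<^sup>+x. ennreal (M ^ j) * ennreal (\<Phi> (norm (f x) / l)) \<partial>\<mu>)"
  proof (rule nn_integral_mono)
    fix x
    have "norm (f x) / k = (l / k) * (norm (f x) / l)"
      using l by simp
    also have "\<dots> \<le> 2 ^ j * (norm (f x) / l)"
      using j l by (intro mult_right_mono) auto
    finally have "\<Phi> (norm (f x) / k) \<le> \<Phi> (2 ^ j * (norm (f x) / l))"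
      using k by (intro young_mono[OF young]) auto
    also have "\<dots> \<le> M ^ j * \<Phi> (norm (f x) / l)"
      using M l by (intro delta2_power) auto
    finally show "ennreal (\<Phi> (norm (f x) / k)) \<le> ennreal (M ^ j) * ennreal (\<Phi> (norm (f x) / l))"
      using M young_nonneg[OF young] by (simp add: ennreal_mult[symmetric] ennreal_leI)
  qed
  also have "\<dots> = ennreal (M ^ j) * modular \<mu> \<Phi> f l"
    by (rule nn_integral_cmult) measurable
  also have "\<dots> < \<infinity>"
    using l(2) by (auto simp: ennreal_mult_less_top order_le_less_trans[OF _ ennreal_one_less_top])
  finally show ?thesis .
qed

text \<open>Truncate \<open>f\<close> to a compact exhaustion and to height \<open>n\<close>. The
  modular of the error tends to 0 by dominated convergence; the dominating function is integrable at
  the given scale \<open>k\<close> thanks to the doubling condition.\<close>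

lemma compactly_supported_dense:
  assumes lc: "locally_compact_space (euclidean :: 'a topology)"
    and M: "M > 0" "\<forall>t>0. \<Phi> (2 * t) \<le> M * \<Phi> t"
    and f: "f \<in> orlicz_functions \<mu> \<Phi>" and k: "k > 0"
  obtains K B g where "compact K" "B > 0" "g \<in> borel_measurable \<mu>" "\<And>x. norm (g x) \<le> B"
    "\<And>x. x \<notin> K \<Longrightarrow> g x = 0" "modular \<mu> \<Phi> (\<lambda>x. f x - g x) k \<le> 1"
proof -
  have fm[measurable]: "f \<in> borel_measurable \<mu>"
    using f by (simp add: orlicz_functions_def)
  obtain K :: "nat \<Rightarrow> 'a set" where K: "\<And>n. compact (K n)" "incseq K" "(\<Union>n. K n) = UNIV"
    by (rule locally_compact_exhaustion[OF lc]) blast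
  have [measurable]: "K n \<in> sets \<mu>" for n
    using K(1) by (rule compact_sets)
  define g where "g n x = (if x \<in> K n \<and> norm (f x) \<le> real n then f x else 0)" for n x
  have [measurable]: "g n \<in> borel_measurable \<mu>" for n
    unfolding g_def by measurable
  have "(\<lambda>n. modular \<mu> \<Phi> (\<lambda>x. f x - g n x) k) \<longlonglongrightarrow> (\<integral>\<^sup>+x. 0 \<partial>\<mu>)"
  proof (rule nn_integral_dominated_convergence[where w = "\<lambda>x. ennreal (\<Phi> (norm (f x) / k))"])
    show "modular \<mu> \<Phi> f k < \<infinity>"
      by (rule orlicz_modular_finite[OF M f k])
    show "AE x in \<mu>. ennreal (\<Phi> (norm (f x - g n x) / k)) \<le> ennreal (\<Phi> (norm (f x) / k))" for n
      using k by (intro AE_I2 ennreal_leI young_mono[OF young] divide_right_mono) (auto simp: g_def)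
    show "AE x in \<mu>. (\<lambda>n. ennreal (\<Phi> (norm (f x - g n x) / k))) \<longlonglongrightarrow> 0"
    proof (rule AE_I2)
      fix x
      obtain m where m: "x \<in> K m"
        using K(3) by blast
      obtain m' where m': "norm (f x) \<le> real m'"
        using real_arch_simple by blast
      have "\<forall>\<^sub>F n in sequentially. ennreal (\<Phi> (norm (f x - g n x) / k)) = 0"
        using eventually_ge_at_top[of "max m m'"]
      proof eventually_elim
        case (elim n)
        then have "x \<in> K n" "norm (f x) \<le> real n"
          using m m' incseqD[OF K(2), of m n] by auto
        then show ?case
          using young by (simp add: g_def young_function_def)
      qed
      then show "(\<lambda>n. ennreal (\<Phi> (norm (f x - g n x) / k))) \<longlonglongrightarrow> 0"
        by (rule tendsto_eventually)
    qed
  qed measurable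
  then have "\<forall>\<^sub>F n in sequentially. modular \<mu> \<Phi> (\<lambda>x. f x - g n x) k < 1"
    by (intro order_tendstoD(2)) auto
  then obtain n where n: "modular \<mu> \<Phi> (\<lambda>x. f x - g n x) k < 1"
    using eventually_happens'[OF sequentially_bot] by blast
  show thesis
  proof (rule that[of "K n" "real n + 1" "g n"])
    \<comment> \<open>The bound is raised by 1 so that it is positive even for
      \<open>n = 0\<close>.\<close>
    show "norm (g n x) \<le> real n + 1" for x
      by (auto simp: g_def)
  qed (use K n in \<open>auto simp: g_def\<close>)
qed

section \<open>From small weights to mixing\<close>

text \<open>Each of the two errors splits into a part bounded by \<open>B\<close> on
  \<open>K - E\<close>, a set of small measure, and a translate of a function on \<open>K\<close> of
  size at most \<open>c * B\<close>. Both have modular at most 1 at scale \<epsilon>/2.\<close>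

lemma small_weight_set_approx:
  assumes K: "compact K" and small: "\<And>c. c > 0 \<Longrightarrow> \<forall>\<^sub>F n in sequentially. \<exists>E. small_weight_set K c n E"
    and [measurable]: "f \<in> borel_measurable \<mu>" "g \<in> borel_measurable \<mu>"
    and B: "B > 0" "\<And>x. norm (f x) \<le> B" "\<And>x. norm (g x) \<le> B"
    and supp: "\<And>x. x \<notin> K \<Longrightarrow> f x = 0" "\<And>x. x \<notin> K \<Longrightarrow> g x = 0" and \<epsilon>: "\<epsilon> > 0"
  shows "\<forall>\<^sub>F n in sequentially. \<exists>h\<in>orlicz_functions \<mu> \<Phi>.
    modular \<mu> \<Phi> (\<lambda>x. f x - h x) \<epsilon> \<le> 1 \<and>
    modular \<mu> \<Phi> (\<lambda>x. g x - (translate_fun a w ^^ n) h x) \<epsilon> \<le> 1"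
proof -
  note compact_sets[OF K, measurable]
  obtain m where m: "emeasure \<mu> K = ennreal m" "m \<ge> 0"
    using compact_finite[OF K] by (cases "emeasure \<mu> K") auto
  define t where "t = B / (\<epsilon> / 2)"
  have t: "t > 0" "\<Phi> t \<ge> 0"
    using B \<epsilon> young_nonneg[OF young] by (auto simp: t_def)
  \<comment> \<open>Small enough for both kinds of error: \<Phi>(t) times the lost measure
    \<open>c\<close>, and, by convexity, c \<Phi>(t) times the measure \<open>m\<close> of
    \<open>K\<close>, are at most 1.\<close>
  define c where "c = 1 / (1 + \<Phi> t * (1 + m))"
  have pos: "1 + \<Phi> t * (1 + m) > 0"
    using t m by (intro add_pos_nonneg) auto
  have c: "c > 0" "c \<le> 1" "c * \<Phi> t \<le> 1" "c * \<Phi> t * m \<le> 1"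
    using t m pos by (auto simp: c_def field_simps)
  have mod_small: "modular \<mu> \<Phi> u (\<epsilon> / 2) \<le> 1"
    if "AE x in \<mu>. norm (u x) \<le> c * B" "\<And>x. x \<notin> K \<Longrightarrow> u x = 0" for u
  proof -
    have "modular \<mu> \<Phi> u (\<epsilon> / 2) \<le> ennreal (\<Phi> (c * B / (\<epsilon> / 2))) * emeasure \<mu> K"
      using that B c \<epsilon> by (intro modular_bounded) auto
    also have "\<Phi> (c * B / (\<epsilon> / 2)) \<le> c * \<Phi> t"
      using young_scale[OF young, of c t] c by (simp add: t_def mult.assoc)
    then have "ennreal (\<Phi> (c * B / (\<epsilon> / 2))) * emeasure \<mu> K \<le> ennreal (c * \<Phi> t) * emeasure \<mu> K"
      by (intro mult_right_mono ennreal_leI) auto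
    also have "\<dots> = ennreal (c * \<Phi> t * m)"
      using c t m by (simp add: ennreal_mult)
    also have "\<dots> \<le> 1"
      using c by (simp add: ennreal_le_1)
    finally show ?thesis .
  qed
  show ?thesis
    using small[OF c(1)]
  proof eventually_elim
    case (elim n)
    then obtain E where E: "small_weight_set K c n E"
      by blast
    then have [measurable]: "E \<in> sets \<mu>" and EK: "E \<subseteq> K" and KE: "emeasure \<mu> (K - E) \<le> ennreal c"
      and AE: "AE x in \<mu>. x \<in> E \<longrightarrow> weight_prod a w n x \<le> c \<and> weight_prod_tilde a w n x \<le> c"
      by (auto simp: small_weight_set_def sets_haar)
    have mod_diff: "modular \<mu> \<Phi> (\<lambda>x. if x \<in> E then 0 else u x) (\<epsilon> / 2) \<le> 1"
      if "\<And>x. norm (u x) \<le> B" "\<And>x. x \<notin> K \<Longrightarrow> u x = 0" for u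
    proof -
      have "modular \<mu> \<Phi> (\<lambda>x. if x \<in> E then 0 else u x) (\<epsilon> / 2)
          \<le> ennreal (\<Phi> (B / (\<epsilon> / 2))) * emeasure \<mu> (K - E)"
        using that B \<epsilon> by (intro modular_bounded) auto
      also have "\<dots> \<le> ennreal (\<Phi> t) * ennreal c"
        unfolding t_def using KE by (intro mult_left_mono) auto
      also have "\<dots> = ennreal (c * \<Phi> t)"
        using c t by (simp add: ennreal_mult mult.commute)
      also have "\<dots> \<le> 1"
        using c by (simp add: ennreal_le_1)
      finally show ?thesis .
    qed
    \<comment> \<open>\<open>u\<close> and \<open>v\<close> are the untranslated forms of \<open>S\<^sup>n (g 1\<^sub>E)\<close> and \<open>T\<^sup>n (f 1\<^sub>E)\<close>.\<close>
    define u where "u x = (if x \<in> E then of_real (weight_prod_tilde a w n x) * g x else 0)" for x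
    define v where "v x = (if x \<in> E then of_real (weight_prod a w n x) * f x else 0)" for x
    have [measurable]: "u \<in> borel_measurable \<mu>" "v \<in> borel_measurable \<mu>"
      unfolding u_def v_def by measurable
    have u0: "u x = 0" and v0: "v x = 0" if "x \<notin> K" for x
      using that EK by (auto simp: u_def v_def)
    have "AE x in \<mu>. norm (u x) \<le> c * B"
      using AE by eventually_elim
        (use B c weight_prod_tilde_pos in \<open>auto simp: u_def norm_mult abs_of_pos intro!: mult_mono\<close>)
    then have u: "modular \<mu> \<Phi> u (\<epsilon> / 2) \<le> 1"
      using u0 by (rule mod_small)
    have "AE x in \<mu>. norm (v x) \<le> c * B"
      using AE by eventually_elim
        (use B c weight_prod_pos in \<open>auto simp: v_def norm_mult abs_of_pos intro!: mult_mono\<close>)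
    then have v: "modular \<mu> \<Phi> v (\<epsilon> / 2) \<le> 1"
      using v0 by (rule mod_small)
    \<comment> \<open>Now \<open>s\<close> is \<open>S\<^sup>n (g 1\<^sub>E)\<close> and
      \<open>r\<close> is \<open>T\<^sup>n (f 1\<^sub>E)\<close>; right invariance of the measure
      leaves the modulars unchanged.\<close>
    define s where "s x = u (x + nmult n a)" for x
    define r where "r x = v (x - nmult n a)" for x
    have [measurable]: "s \<in> borel_measurable \<mu>" "r \<in> borel_measurable \<mu>"
      unfolding s_def r_def by measurable
    have s: "modular \<mu> \<Phi> s (\<epsilon> / 2) \<le> 1"
      using nn_integral_translation[of "\<lambda>x. ennreal (\<Phi> (norm (u x) / (\<epsilon> / 2)))" "- nmult n a"] u
      by (simp add: s_def)
    have r: "modular \<mu> \<Phi> r (\<epsilon> / 2) \<le> 1"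
      using nn_integral_translation[of "\<lambda>x. ennreal (\<Phi> (norm (v x) / (\<epsilon> / 2)))" "nmult n a"] v
      by (simp add: r_def)
    define h where "h x = (if x \<in> E then f x else 0) + s x" for x
    have so: "s \<in> orlicz_functions \<mu> \<Phi>"
      using s \<epsilon> by (intro orlicz_functionsI[of _ _ "\<epsilon> / 2"]) auto
    have "(\<lambda>x. if x \<in> E then f x else 0) \<in> orlicz_functions \<mu> \<Phi>"
      by (rule bounded_orlicz[OF K, of _ B]) (use B supp in auto)
    \<comment> \<open>A sum as a double difference: subtracting \<open>0 - s\<close> adds
      \<open>s\<close>.\<close>
    from orlicz_diff[OF young this orlicz_diff[OF young _ so, of "\<lambda>_. 0"]]
    have ho: "h \<in> orlicz_functions \<mu> \<Phi>"
      using bounded_orlicz[OF K, of "\<lambda>_. 0" 0] by (simp add: h_def[abs_def])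
    have "modular \<mu> \<Phi> (\<lambda>x. (if x \<in> E then 0 else f x) + - s x) (\<epsilon> / 2 + \<epsilon> / 2) \<le> 1"
      by (rule modular_add[OF young]) (use s \<epsilon> mod_diff[OF B(2) supp(1)] in auto)
    moreover have "(if x \<in> E then 0 else f x) + - s x = f x - h x" for x
      by (simp add: h_def)
    ultimately have 1: "modular \<mu> \<Phi> (\<lambda>x. f x - h x) \<epsilon> \<le> 1"
      by (simp only: field_sum_of_halves)
    have "modular \<mu> \<Phi> (\<lambda>x. (if x \<in> E then 0 else g x) + - r x) (\<epsilon> / 2 + \<epsilon> / 2) \<le> 1"
      by (rule modular_add[OF young]) (use r \<epsilon> mod_diff[OF B(3) supp(2)] in auto)
    moreover have "(if x \<in> E then 0 else g x) + - r x = g x - (translate_fun a w ^^ n) h x" for x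
    proof -
      have "inverse (weight_prod_tilde a w n x) = weight_prod a w n (x - nmult n a)"
        using inverse_weight_prod_tilde_translate[of n "x - nmult n a"] by simp
      then have "r x = of_real (inverse (weight_prod_tilde a w n x)) * (if x - nmult n a \<in> E then f (x - nmult n a) else 0)"
        by (simp add: r_def v_def)
      moreover have "of_real (inverse (weight_prod_tilde a w n x)) * s (x - nmult n a) = (if x \<in> E then g x else 0)"
        using weight_prod_tilde_pos[of n x] by (simp add: s_def u_def)
      ultimately have "(translate_fun a w ^^ n) h x = r x + (if x \<in> E then g x else 0)"
        unfolding translate_fun_funpow h_def by (simp add: distrib_left)
      then show ?thesis
        by simp
    qed
    ultimately have "modular \<mu> \<Phi> (\<lambda>x. g x - (translate_fun a w ^^ n) h x) \<epsilon> \<le> 1"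
      by (simp only: field_sum_of_halves)
    with ho 1 show ?case
      by blast
  qed
qed

text \<open>By density both targets become bounded functions with compact supports; the union of the
  supports is the set \<open>K\<close> to which the approximation is applied.\<close>

lemma mixing_if_small_weight_sets:
  assumes lc: "locally_compact_space (euclidean :: 'a topology)"
    and M: "M > 0" "\<forall>t>0. \<Phi> (2 * t) \<le> M * \<Phi> t"
    and small: "\<And>K c. compact K \<Longrightarrow> emeasure \<mu> K > 0 \<Longrightarrow> c > 0 \<Longrightarrow>
      \<forall>\<^sub>F n in sequentially. \<exists>E. small_weight_set K c n E"
  shows "topologically_mixing (orlicz_topology \<mu> \<Phi>) (weighted_translation \<mu> \<Phi> a w)"
  unfolding topologically_mixing_iff
proof (intro ballI allI impI)
  fix f g and \<epsilon> :: real
  assume f: "f \<in> orlicz_functions \<mu> \<Phi>" and g: "g \<in> orlicz_functions \<mu> \<Phi>" and \<epsilon>: "\<epsilon> > 0"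
  have small': "\<forall>\<^sub>F n in sequentially. \<exists>E. small_weight_set K c n E" if "compact K" "c > 0" for K c
  proof (cases "emeasure \<mu> K = 0")
    case True
    then show ?thesis
      by (auto simp: small_weight_set_def intro!: always_eventually exI[of _ "{}"])
  next
    case False
    then show ?thesis
      using that by (intro small) (auto simp: zero_less_iff_neq_zero)
  qed
  have \<epsilon>4: "\<epsilon> / 4 > 0"
    using \<epsilon> by simp
  obtain K1 B1 f' where f': "compact K1" "B1 > 0" "f' \<in> borel_measurable \<mu>" "\<And>x. norm (f' x) \<le> B1"
    "\<And>x. x \<notin> K1 \<Longrightarrow> f' x = 0" "modular \<mu> \<Phi> (\<lambda>x. f x - f' x) (\<epsilon> / 4) \<le> 1"
    by (rule compactly_supported_dense[OF lc M f \<epsilon>4]) (rule that; assumption)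
  obtain K2 B2 g' where g': "compact K2" "B2 > 0" "g' \<in> borel_measurable \<mu>" "\<And>x. norm (g' x) \<le> B2"
    "\<And>x. x \<notin> K2 \<Longrightarrow> g' x = 0" "modular \<mu> \<Phi> (\<lambda>x. g x - g' x) (\<epsilon> / 4) \<le> 1"
    by (rule compactly_supported_dense[OF lc M g \<epsilon>4]) (rule that; assumption)
  \<comment> \<open>Two errors at scale \<epsilon>/4 add up to a norm of at most \<epsilon>/2, which
    leaves room for the strict inequality.\<close>
  have close: "luxemburg_norm \<mu> \<Phi> (\<lambda>x. p x - q x) < \<epsilon>"
    if pq: "modular \<mu> \<Phi> (\<lambda>x. p x - p' x) (\<epsilon> / 4) \<le> 1" "modular \<mu> \<Phi> (\<lambda>x. p' x - q x) (\<epsilon> / 4) \<le> 1"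
      and m[measurable]: "p \<in> borel_measurable \<mu>" "p' \<in> borel_measurable \<mu>" "q \<in> borel_measurable \<mu>" for p p' q
  proof -
    have "modular \<mu> \<Phi> (\<lambda>x. (p x - p' x) + (p' x - q x)) (\<epsilon> / 4 + \<epsilon> / 4) \<le> 1"
      by (rule modular_add[OF young]) (use pq \<epsilon> in auto)
    then have "luxemburg_norm \<mu> \<Phi> (\<lambda>x. p x - q x) \<le> \<epsilon> / 2"
      using \<epsilon> by (intro luxemburg_le) auto
    then show ?thesis
      using \<epsilon> by simp
  qed
  have "\<forall>\<^sub>F n in sequentially. \<exists>h\<in>orlicz_functions \<mu> \<Phi>.
    modular \<mu> \<Phi> (\<lambda>x. f' x - h x) (\<epsilon> / 4) \<le> 1 \<and>
    modular \<mu> \<Phi> (\<lambda>x. g' x - (translate_fun a w ^^ n) h x) (\<epsilon> / 4) \<le> 1"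
  proof (rule small_weight_set_approx[where K = "K1 \<union> K2" and B = "max B1 B2"])
    show "norm (f' x) \<le> max B1 B2" "norm (g' x) \<le> max B1 B2" for x
      using f'(4)[of x] g'(4)[of x] by auto
    show "\<forall>\<^sub>F n in sequentially. \<exists>E. small_weight_set (K1 \<union> K2) c n E" if "c > 0" for c
      using compact_Un[OF f'(1) g'(1)] that by (rule small')
  qed (use f' g' \<epsilon> in auto)
  then show "\<forall>\<^sub>F n in sequentially.
      \<exists>h\<in>orlicz_functions \<mu> \<Phi>. luxemburg_norm \<mu> \<Phi> (\<lambda>x. f x - h x) < \<epsilon> \<and>
        luxemburg_norm \<mu> \<Phi> (\<lambda>x. g x - (translate_fun a w ^^ n) h x) < \<epsilon>"
  proof eventually_elim
    case (elim n)
    then obtain h where h: "h \<in> orlicz_functions \<mu> \<Phi>"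
      "modular \<mu> \<Phi> (\<lambda>x. f' x - h x) (\<epsilon> / 4) \<le> 1"
      "modular \<mu> \<Phi> (\<lambda>x. g' x - (translate_fun a w ^^ n) h x) (\<epsilon> / 4) \<le> 1"
      by blast
    have m: "p \<in> orlicz_functions \<mu> \<Phi> \<Longrightarrow> p \<in> borel_measurable \<mu>" for p
      by (simp add: orlicz_functions_def)
    show ?case
      using close[OF f'(6) h(2)] close[OF g'(6) h(3)] m[OF f] m[OF g] m[OF h(1)] f'(3) g'(3)
        m[OF translate_fun_funpow_orlicz[OF h(1)]] h(1)
      by blast
  qed
qed

section \<open>From mixing to small weights\<close>

text \<open>Where \<open>u\<close> has size at least \<delta>, its quotient by \<delta>/T is at
  least \<open>T\<close>, so the integrand is at least 1/\<eta>, while the whole modular at scale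
  \<delta>/T is at most 1.\<close>

lemma chebyshev_luxemburg:
  assumes u: "u \<in> orlicz_functions \<mu> \<Phi>" "luxemburg_norm \<mu> \<Phi> u < \<delta> / T"
    and pos: "\<delta> > 0" "T > 0" "\<eta> > 0" and T: "\<Phi> T \<ge> 1 / \<eta>"
  shows "emeasure \<mu> {x. \<delta> \<le> norm (u x)} \<le> ennreal \<eta>"
proof -
  have [measurable]: "u \<in> borel_measurable \<mu>"
    using u by (simp add: orlicz_functions_def)
  let ?A = "{x. \<delta> \<le> norm (u x)}"
  have "{x \<in> space \<mu>. \<delta> \<le> norm (u x)} \<in> sets \<mu>"
    by measurable
  then have A: "?A \<in> sets \<mu>"
    by simp
  have "ennreal (1 / \<eta>) * emeasure \<mu> ?A = (\<integral>\<^sup>+x. ennreal (1 / \<eta>) * indicator ?A x \<partial>\<mu>)"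
    by (rule nn_integral_cmult_indicator[symmetric]) (rule A)
  also have "\<dots> \<le> modular \<mu> \<Phi> u (\<delta> / T)"
  proof (rule nn_integral_mono)
    fix x
    show "ennreal (1 / \<eta>) * indicator ?A x \<le> ennreal (\<Phi> (norm (u x) / (\<delta> / T)))"
    proof (cases "x \<in> ?A")
      case True
      then have "T \<le> norm (u x) / (\<delta> / T)"
        using pos by (simp add: field_simps)
      then have "\<Phi> T \<le> \<Phi> (norm (u x) / (\<delta> / T))"
        using pos by (intro young_mono[OF young]) auto
      then show ?thesis
        using True T by (simp add: ennreal_leI)
    qed simp
  qed
  also have "\<dots> \<le> 1"
    using luxemburg_less[OF young u] by simp
  finally have "ennreal \<eta> * (ennreal (1 / \<eta>) * emeasure \<mu> ?A) \<le> ennreal \<eta> * 1"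
    by (rule mult_left_mono) simp
  moreover have "ennreal \<eta> * ennreal (1 / \<eta>) = 1"
    using pos by (simp add: ennreal_mult[symmetric])
  ultimately show ?thesis
    by (simp add: mult.assoc[symmetric])
qed

lemma small_weight_sets_if_mixing:
  assumes disj: "\<forall>\<^sub>F n in sequentially. \<forall>x\<in>K. x + nmult n a \<notin> K \<and> x - nmult n a \<notin> K"
    and mixing: "topologically_mixing (orlicz_topology \<mu> \<Phi>) (weighted_translation \<mu> \<Phi> a w)"
    and K: "compact K" and c: "c > 0"
  shows "\<forall>\<^sub>F n in sequentially. \<exists>E. small_weight_set K c n E"
proof -
  note compact_sets[OF K, measurable]
  \<comment> \<open>The bound 1/4 keeps values within \<delta> of 1 above 1/2 in modulus, and c/2
    makes the resulting quotient at most \<open>c\<close>.\<close>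
  define \<delta> where "\<delta> = min (1 / 4) (c / 2)"
  have \<delta>: "\<delta> > 0" "\<delta> \<le> 1 / 4" "2 * \<delta> \<le> c"
    using c by (auto simp: \<delta>_def)
  have "\<forall>\<^sub>F t in at_top. 1 / (c / 4) \<le> \<Phi> t"
    using young by (auto simp: young_function_def filterlim_at_top)
  then have "\<forall>\<^sub>F t in at_top. 1 / (c / 4) \<le> \<Phi> t \<and> 0 < t"
    using eventually_gt_at_top by (rule eventually_conj)
  \<comment> \<open>With this \<open>T\<close> each of the four exceptional sets below has measure
    at most \<open>c / 4\<close>.\<close>
  then obtain T where T: "T > 0" "1 / (c / 4) \<le> \<Phi> T"
    by (metis (mono_tags, lifting) eventually_happens trivial_limit_at_top_linorder)
  define \<kappa> :: "'a \<Rightarrow> complex" where "\<kappa> x = (if x \<in> K then 1 else 0)" for x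
  have \<kappa>: "\<kappa> \<in> orlicz_functions \<mu> \<Phi>"
    by (rule bounded_orlicz[OF K, of _ 1]) (auto simp: \<kappa>_def[abs_def])
  have "\<forall>\<^sub>F n in sequentially.
      \<exists>h\<in>orlicz_functions \<mu> \<Phi>. luxemburg_norm \<mu> \<Phi> (\<lambda>x. \<kappa> x - h x) < \<delta> / T \<and>
        luxemburg_norm \<mu> \<Phi> (\<lambda>x. \<kappa> x - (translate_fun a w ^^ n) h x) < \<delta> / T"
    using mixing[unfolded topologically_mixing_iff] \<kappa> \<delta>(1) T(1) by (meson divide_pos_pos)
  then show ?thesis
    using disj
  proof eventually_elim
    case (elim n)
    then obtain h where h: "h \<in> orlicz_functions \<mu> \<Phi>" "luxemburg_norm \<mu> \<Phi> (\<lambda>x. \<kappa> x - h x) < \<delta> / T"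
        "luxemburg_norm \<mu> \<Phi> (\<lambda>x. \<kappa> x - (translate_fun a w ^^ n) h x) < \<delta> / T"
      by blast
    define Th where "Th = (translate_fun a w ^^ n) h"
    have Th: "Th \<in> orlicz_functions \<mu> \<Phi>"
      unfolding Th_def by (rule translate_fun_funpow_orlicz[OF h(1)])
    have [measurable]: "h \<in> borel_measurable \<mu>" "Th \<in> borel_measurable \<mu>" "\<kappa> \<in> borel_measurable \<mu>"
      using h(1) Th \<kappa> by (auto simp: orlicz_functions_def)
    define A where "A = {x. \<delta> \<le> norm (\<kappa> x - h x)}"
    define D where "D = {x. \<delta> \<le> norm (\<kappa> x - Th x)}"
    have "{x \<in> space \<mu>. \<delta> \<le> norm (\<kappa> x - h x)} \<in> sets \<mu>" "{x \<in> space \<mu>. \<delta> \<le> norm (\<kappa> x - Th x)} \<in> sets \<mu>"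
      by measurable
    then have [measurable]: "A \<in> sets \<mu>" "D \<in> sets \<mu>"
      by (simp_all add: A_def D_def)
    have "{x \<in> space \<mu>. x + nmult n a \<in> D} \<in> sets \<mu>" "{x \<in> space \<mu>. x - nmult n a \<in> A} \<in> sets \<mu>"
      by measurable
    then have [measurable]: "{x. x + nmult n a \<in> D} \<in> sets \<mu>" "{x. x - nmult n a \<in> A} \<in> sets \<mu>"
      by simp_all
    have mA: "emeasure \<mu> A \<le> ennreal (c / 4)"
      unfolding A_def using T \<delta> c h(2) by (intro chebyshev_luxemburg[OF orlicz_diff[OF young \<kappa> h(1)]]) auto
    have mD: "emeasure \<mu> D \<le> ennreal (c / 4)"
      unfolding D_def using T \<delta> c h(3)
      by (intro chebyshev_luxemburg[OF orlicz_diff[OF young \<kappa> Th]]) (auto simp: Th_def)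
    \<comment> \<open>Outside the removed sets \<open>h\<close> is near the indicator at
      \<open>x\<close> and at \<open>x - nmult n a\<close>, and \<open>Th\<close> at
      \<open>x\<close> and at \<open>x + nmult n a\<close>. The two translated sets have the
      measures of \<open>D\<close> and \<open>A\<close> by right invariance.\<close>
    define E where "E = K - (A \<union> D \<union> {x. x + nmult n a \<in> D} \<union> {x. x - nmult n a \<in> A})"
    have [measurable]: "E \<in> sets \<mu>"
      unfolding E_def by measurable
    have "emeasure \<mu> (K - E) \<le> emeasure \<mu> (A \<union> D \<union> {x. x + nmult n a \<in> D} \<union> {x. x - nmult n a \<in> A})"
      by (intro emeasure_mono) (auto simp: E_def)
    also have "\<dots> \<le> emeasure \<mu> A + emeasure \<mu> D + emeasure \<mu> {x. x + nmult n a \<in> D} + emeasure \<mu> {x. x - nmult n a \<in> A}"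
      by (intro order_trans[OF emeasure_subadditive] add_mono order_refl) auto
    also have "\<dots> \<le> ennreal (c / 4) + ennreal (c / 4) + ennreal (c / 4) + ennreal (c / 4)"
      using emeasure_translation_vimage[of D "nmult n a"] emeasure_translation_vimage[of A "- nmult n a"] mA mD
      by (intro add_mono) auto
    also have "\<dots> = ennreal c"
      using c by (simp add: ennreal_plus[symmetric] del: ennreal_plus)
    finally have KE: "emeasure \<mu> (K - E) \<le> ennreal c" .
    have ratio: "p \<le> c" if "p * s \<le> \<delta>" "s \<ge> 1 - \<delta>" "p > 0" for p s
    proof -
      have "p * (1 / 2) \<le> p * s"
        using that \<delta> by (intro mult_left_mono) auto
      then show ?thesis
        using that \<delta> by linarith
    qed
    have "weight_prod a w n x \<le> c \<and> weight_prod_tilde a w n x \<le> c" if "x \<in> E" for x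
    proof
      have x: "x \<in> K" "norm (1 - h x) < \<delta>" "norm (1 - Th x) < \<delta>"
        and "x + nmult n a \<notin> D" "x - nmult n a \<notin> A"
        using that by (auto simp: E_def A_def D_def \<kappa>_def)
      \<comment> \<open>Disjointness enters here: both translates of \<open>x\<close> lie outside
        \<open>K\<close>, where the indicator is 0.\<close>
      then have y: "norm (Th (x + nmult n a)) < \<delta>" "norm (h (x - nmult n a)) < \<delta>"
        using elim(2) by (auto simp: A_def D_def \<kappa>_def)
      have ge: "norm (h x) \<ge> 1 - \<delta>" "norm (Th x) \<ge> 1 - \<delta>"
        using x(2,3) norm_triangle_ineq2[of 1 "h x"] norm_triangle_ineq2[of 1 "Th x"] by simp_all
      have "Th (x + nmult n a) = of_real (weight_prod a w n x) * h x"
        unfolding Th_def translate_fun_funpow inverse_weight_prod_tilde_translate by simp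
      then have "weight_prod a w n x * norm (h x) \<le> \<delta>"
        using y(1) weight_prod_pos[of n x] by (simp add: norm_mult)
      then show "weight_prod a w n x \<le> c"
        using ge(1) weight_prod_pos by (rule ratio)
      have "h (x - nmult n a) = of_real (weight_prod_tilde a w n x) * Th x"
        unfolding Th_def translate_fun_funpow using weight_prod_tilde_pos[of n x] by simp
      then have "weight_prod_tilde a w n x * norm (Th x) \<le> \<delta>"
        using y(2) weight_prod_tilde_pos[of n x] by (simp add: norm_mult)
      then show "weight_prod_tilde a w n x \<le> c"
        using ge(2) weight_prod_tilde_pos by (rule ratio)
    qed
    then have "small_weight_set K c n E"
      using KE \<open>E \<in> sets \<mu>\<close> unfolding small_weight_set_def sets_haar by (auto simp: E_def)
    then show ?case ..
  qed
qed

end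

theorem corollary2p7:
  fixes \<mu> :: "'a::{topological_group_add, t2_space, second_countable_topology} measure"
    and a :: 'a and w :: "'a \<Rightarrow> real" and \<Phi> :: "real \<Rightarrow> real"
  assumes "locally_compact_space (euclidean :: 'a topology)"
    and "right_haar_measure \<mu>"
    and "aperiodic a"
    and "weight w"
    and "w \<in> linfty \<mu>" and "(\<lambda>x. inverse (w x)) \<in> linfty \<mu>"
    and "young_function \<Phi>" and "delta2_regular TYPE('a) \<Phi>"
  shows "topologically_mixing (orlicz_topology \<mu> \<Phi>) (weighted_translation \<mu> \<Phi> a w) \<longleftrightarrow>
    (\<forall>K. compact K \<and> emeasure \<mu> K > 0 \<longrightarrow>
      (\<exists>E :: nat \<Rightarrow> 'a set.
        (\<forall>n\<ge>1. E n \<in> sets borel \<and> E n \<subseteq> K) \<and>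
        (\<lambda>n. emeasure \<mu> (E n)) \<longlonglongrightarrow> emeasure \<mu> K \<and>
        (\<lambda>n. linfty_norm (restrict_space \<mu> (E n)) (weight_prod a w n)) \<longlonglongrightarrow> 0 \<and>
        (\<lambda>n. linfty_norm (restrict_space \<mu> (E n)) (weight_prod_tilde a w n)) \<longlonglongrightarrow> 0))"
proof -
  interpret weighted_orlicz \<mu> a w \<Phi>
    by (rule weighted_orlicz.intro) (fact assms)+
  \<comment> \<open>In a compact group every closed subgroup is compact. Thus the noncompact case of
    \<open>delta2_regular\<close> applies and gives doubling for all positive arguments.\<close>
  have "\<not> compact (UNIV :: 'a set)"
    using assms(3) compact_Int_closed[OF _ closed_hull_closed_subgroup, of UNIV "{a}"]
    by (auto simp: aperiodic_def)
  then obtain M where M: "M > 0" "\<forall>t>0. \<Phi> (2 * t) \<le> M * \<Phi> t"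
    using assms(8) by (auto simp: delta2_regular_def)
  have "topologically_mixing (orlicz_topology \<mu> \<Phi>) (weighted_translation \<mu> \<Phi> a w) \<longleftrightarrow>
    (\<forall>K. compact K \<and> emeasure \<mu> K > 0 \<longrightarrow>
      (\<forall>c>0. \<forall>\<^sub>F n in sequentially. \<exists>E. small_weight_set K c n E))"
    (is "?mixing \<longleftrightarrow> ?small")
  proof
    assume ?mixing
    then show ?small
      using small_weight_sets_if_mixing[OF aperiodic_eventually_disjoint[OF assms(1,3)]] by simp
  next
    assume small: ?small
    show ?mixing
      by (rule mixing_if_small_weight_sets[OF assms(1) M]) (use small in simp_all)
  qed
  then show ?thesis
    using vanishing_weights_iff by simp
qed

end
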